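(* Let $\Gamma$ be a commutative group and $T=(T,u)$ a commutative ternary $\Gamma$-semiring. Each $\sigma\in\mathrm{Aut}_\Gamma(T)$ induces: 1. a homeomorphism $\sigma^\ast:\mathrm{Spec}_\Gamma(T)\to\mathrm{Spec}_\Gamma(T)$, $P\mapsto\sigma^{-1}(P)$, and 2. an isomorphism of sheaves of ternary $\Gamma$-semirings $\sigma^\#:\mathcal{O}_T\to(\sigma^\ast)_\ast\mathcal{O}_T$. Moreover, $\sigma^\#$ preserves the triadic bracket $\{s_1,s_2,s_3\}_{\gamma,U}=s_1\cdot s_2\cdot s_3\cdot u_\gamma$ on sections, for all opens $U\subseteq \mathrm{Spec}_\Gamma(T)$ and all $\gamma\in\Gamma$.
   Context: A commutative semiring is a tuple $(T,+,\cdot,0,1)$ with $(T,+,0)$ and $(T,\cdot,1)$ commutative monoids, multiplication distributing over addition, and $0\cdot x=x\cdot 0=0$. A commutative ternary $\Gamma$-semiring $(T,u)$ is a commutative semiring $T$ with a group homomorphism $u:\Gamma\to T^\times$, $\gamma\mapsto u_\gamma$, together with the operations $\{a\,b\,c\}_\gamma:=a b c u_\gamma$. $\mathrm{Aut}_\Gamma(T)$ is the group of semiring automorphisms $\sigma$ of $T$ with $\sigma(u_\gamma)=u_\gamma$ for all $\gamma\in\Gamma$. A $\Gamma$-ideal of $T$ is a subset $I$ which is a submonoid of $(T,+,0)$ and satisfies $\{a\,b\,c\}_\gamma\in I$ for all $a\in I$, $b,c\in T$, $\gamma\in\Gamma$. A proper $\Gamma$-ideal $P$ is prime if $\{a\,b\,c\}_\gamma\in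 P$ implies $a\in P$ or $b\in P$ or $c\in P$, for all $a,b,c\in T$, $\gamma\in\Gamma$. $\mathrm{Spec}_\Gamma(T)$ is the set of prime $\Gamma$-ideals with the topology whose closed sets are $V(I)=\{P\mid I\subseteq P\}$ for $\Gamma$-ideals $I$; the principal opens $D_\Gamma(f)=\{P\mid f\notin P\}$ form a basis. For $f\in T$, $T_f$ is the localization of the semiring $T$ at $S_f=\{1,f,f^2,\dots\}$: fractions $\frac as$ with $\frac as=\frac bt$ iff $wat=wbs$ for some $w\in S_f$, and the usual operations. The structure sheaf $\mathcal{O}_T$ is the unique sheaf of semirings on $\mathrm{Spec}_\Gamma(T)$ extending $\mathcal{O}_T(D_\Gamma(f))=T_f$, with restriction $T_f\to T_g$ for $D_\Gamma(g)\subseteq D_\Gamma(f)$ the unique semiring homomorphism compatible with the canonical maps from $T$. Each $\mathcal{O}_T(U)$ is a ternary $\Gamma$-semiring via the unit sections induced by the $u_\gamma$; the triadic bracket uses the multiplication of $\mathcal{O}_T(U)$ and these unit sections. *)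

theory Defs
  imports "HOL-Algebra.QuotRing" "HOL-Analysis.Abstract_Topology"
begin

section \<open>Commutative semirings and ternary \<open>\<Gamma>\<close>-semirings\<close>

locale csemiring = semiring + comm_monoid R

text \<open>
  Unlike for rings, preservation of zero is not a consequence of membership in
  \<^const>\<open>ring_hom\<close>.
\<close>

definition semiring_hom :: "('a, 'm) ring_scheme \<Rightarrow> ('b, 'n) ring_scheme \<Rightarrow> ('a \<Rightarrow> 'b) set" where
  "semiring_hom R S = {h \<in> ring_hom R S. h \<zero>\<^bsub>R\<^esub> = \<zero>\<^bsub>S\<^esub>}"

definition semiring_iso :: "('a, 'm) ring_scheme \<Rightarrow> ('b, 'n) ring_scheme \<Rightarrow> ('a \<Rightarrow> 'b) set" where
  "semiring_iso R S = {h \<in> semiring_hom R S. bij_betw h (carrier R) (carrier S)}"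

locale ternary_semiring =
  \<Gamma>: comm_group \<Gamma> + csemiring T for \<Gamma> :: "('g, 'k) monoid_scheme" and T :: "('a, 'm) ring_scheme" (structure) +
  fixes u :: "'g \<Rightarrow> 'a"
  assumes u_hom: "u \<in> hom \<Gamma> (units_of T)"

definition bracket :: "('a, 'm) ring_scheme \<Rightarrow> ('g \<Rightarrow> 'a) \<Rightarrow> 'g \<Rightarrow> 'a \<Rightarrow> 'a \<Rightarrow> 'a \<Rightarrow> 'a" where
  "bracket T u \<gamma> a b c = a \<otimes>\<^bsub>T\<^esub> b \<otimes>\<^bsub>T\<^esub> c \<otimes>\<^bsub>T\<^esub> u \<gamma>"

definition ternary_iso ::
  "('g, 'k) monoid_scheme \<Rightarrow> ('a, 'm) ring_scheme \<Rightarrow> ('g \<Rightarrow> 'a) \<Rightarrow>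
   ('b, 'n) ring_scheme \<Rightarrow> ('g \<Rightarrow> 'b) \<Rightarrow> ('a \<Rightarrow> 'b) set" where
  "ternary_iso \<Gamma> R u S v = {h \<in> semiring_iso R S. \<forall>\<gamma>\<in>carrier \<Gamma>. h (u \<gamma>) = v \<gamma>}"

definition Aut_\<Gamma> ::
  "('g, 'k) monoid_scheme \<Rightarrow> ('a, 'm) ring_scheme \<Rightarrow> ('g \<Rightarrow> 'a) \<Rightarrow> ('a \<Rightarrow> 'a) set" where
  "Aut_\<Gamma> \<Gamma> T u = ternary_iso \<Gamma> T u T u"


section \<open>The prime spectrum\<close>

definition gamma_ideal ::
  "('g, 'k) monoid_scheme \<Rightarrow> ('a, 'm) ring_scheme \<Rightarrow> ('g \<Rightarrow> 'a) \<Rightarrow> 'a set \<Rightarrow> bool" where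
  "gamma_ideal \<Gamma> T u I \<longleftrightarrow>
     submonoid I (add_monoid T) \<and>
     (\<forall>a\<in>I. \<forall>b\<in>carrier T. \<forall>c\<in>carrier T. \<forall>\<gamma>\<in>carrier \<Gamma>. bracket T u \<gamma> a b c \<in> I)"

definition prime_gamma_ideal ::
  "('g, 'k) monoid_scheme \<Rightarrow> ('a, 'm) ring_scheme \<Rightarrow> ('g \<Rightarrow> 'a) \<Rightarrow> 'a set \<Rightarrow> bool" where
  "prime_gamma_ideal \<Gamma> T u P \<longleftrightarrow>
     gamma_ideal \<Gamma> T u P \<and> P \<noteq> carrier T \<and>
     (\<forall>a\<in>carrier T. \<forall>b\<in>carrier T. \<forall>c\<in>carrier T. \<forall>\<gamma>\<in>carrier \<Gamma>.
        bracket T u \<gamma> a b c \<in> P \<longrightarrow> a \<in> P \<or> b \<in> P \<or> c \<in> P)"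

definition Spec :: "('g, 'k) monoid_scheme \<Rightarrow> ('a, 'm) ring_scheme \<Rightarrow> ('g \<Rightarrow> 'a) \<Rightarrow> 'a set set" where
  "Spec \<Gamma> T u = {P. prime_gamma_ideal \<Gamma> T u P}"

definition V :: "('g, 'k) monoid_scheme \<Rightarrow> ('a, 'm) ring_scheme \<Rightarrow> ('g \<Rightarrow> 'a) \<Rightarrow> 'a set \<Rightarrow> 'a set set" where
  "V \<Gamma> T u I = {P \<in> Spec \<Gamma> T u. I \<subseteq> P}"

definition D :: "('g, 'k) monoid_scheme \<Rightarrow> ('a, 'm) ring_scheme \<Rightarrow> ('g \<Rightarrow> 'a) \<Rightarrow> 'a \<Rightarrow> 'a set set" where
  "D \<Gamma> T u f = {P \<in> Spec \<Gamma> T u. f \<notin> P}"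

definition spec_open ::
  "('g, 'k) monoid_scheme \<Rightarrow> ('a, 'm) ring_scheme \<Rightarrow> ('g \<Rightarrow> 'a) \<Rightarrow> 'a set set \<Rightarrow> bool" where
  "spec_open \<Gamma> T u U \<longleftrightarrow> (\<exists>I. gamma_ideal \<Gamma> T u I \<and> U = Spec \<Gamma> T u - V \<Gamma> T u I)"

definition spec_topology ::
  "('g, 'k) monoid_scheme \<Rightarrow> ('a, 'm) ring_scheme \<Rightarrow> ('g \<Rightarrow> 'a) \<Rightarrow> 'a set topology" where
  "spec_topology \<Gamma> T u = topology (spec_open \<Gamma> T u)"

context ternary_semiring
begin

lemma u_closed: "\<gamma> \<in> carrier \<Gamma> \<Longrightarrow> u \<gamma> \<in> carrier T"
  using hom_in_carrier[OF u_hom] by (auto simp: units_of_def Units_def)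

lemma u_one: "u \<one>\<^bsub>\<Gamma>\<^esub> = \<one>"
  using hom_one[OF u_hom \<Gamma>.is_group units_group] by (simp add: units_of_def)

lemma bracket_one:
  "a \<in> carrier T \<Longrightarrow> b \<in> carrier T \<Longrightarrow> bracket T u \<one>\<^bsub>\<Gamma>\<^esub> a b \<one> = a \<otimes> b"
  by (simp add: bracket_def u_one)

lemma gamma_ideal_subset: "gamma_ideal \<Gamma> T u I \<Longrightarrow> I \<subseteq> carrier T"
  unfolding gamma_ideal_def using submonoid.subset by fastforce

lemma gamma_ideal_mult:
  assumes "gamma_ideal \<Gamma> T u I" "a \<in> I" "b \<in> carrier T"
  shows "a \<otimes> b \<in> I" "b \<otimes> a \<in> I"
proof -
  have a: "a \<in> carrier T" using gamma_ideal_subset[OF assms(1)] assms(2) by auto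
  have "bracket T u \<one>\<^bsub>\<Gamma>\<^esub> a b \<one> \<in> I"
    using assms unfolding gamma_ideal_def by blast
  then show "a \<otimes> b \<in> I" using a assms(3) by (simp add: bracket_one)
  then show "b \<otimes> a \<in> I" using a assms(3) by (simp add: m_comm)
qed

lemma gamma_ideal_Inter:
  assumes "\<I> \<noteq> {}" "\<And>I. I \<in> \<I> \<Longrightarrow> gamma_ideal \<Gamma> T u I"
  shows "gamma_ideal \<Gamma> T u (\<Inter>\<I>)"
  using assms unfolding gamma_ideal_def submonoid_def by (simp; blast)

lemma gamma_ideal_carrier: "gamma_ideal \<Gamma> T u (carrier T)"
  unfolding gamma_ideal_def submonoid_def bracket_def using u_closed by simp

lemma istopology_spec_open: "istopology (spec_open \<Gamma> T u)"
  unfolding istopology_def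
proof (intro conjI allI impI)
  fix A B assume "spec_open \<Gamma> T u A" "spec_open \<Gamma> T u B"
  then obtain I J where I: "gamma_ideal \<Gamma> T u I" "A = Spec \<Gamma> T u - V \<Gamma> T u I"
    and J: "gamma_ideal \<Gamma> T u J" "B = Spec \<Gamma> T u - V \<Gamma> T u J"
    unfolding spec_open_def by blast
  have IJ: "gamma_ideal \<Gamma> T u (I \<inter> J)"
    using gamma_ideal_Inter[of "{I, J}"] I J by auto
  have "I \<subseteq> P \<or> J \<subseteq> P" if P: "P \<in> Spec \<Gamma> T u" and sub: "I \<inter> J \<subseteq> P" for P
  proof (rule ccontr)
    assume "\<not> (I \<subseteq> P \<or> J \<subseteq> P)"
    then obtain a b where ab: "a \<in> I" "a \<notin> P" "b \<in> J" "b \<notin> P" by blast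
    have c: "a \<in> carrier T" "b \<in> carrier T"
      using ab I J gamma_ideal_subset by blast+
    have pr: "prime_gamma_ideal \<Gamma> T u P" using P by (simp add: Spec_def)
    then have gi: "gamma_ideal \<Gamma> T u P" and ne: "P \<noteq> carrier T"
      by (simp_all add: prime_gamma_ideal_def)
    have "\<one> \<notin> P"
    proof
      assume "\<one> \<in> P"
      then have "carrier T \<subseteq> P" using gamma_ideal_mult[OF gi \<open>\<one> \<in> P\<close>] by fastforce
      then show False using gamma_ideal_subset[OF gi] ne by blast
    qed
    moreover have "a \<otimes> b \<in> I \<inter> J" using gamma_ideal_mult I J ab c by blast
    then have "bracket T u \<one>\<^bsub>\<Gamma>\<^esub> a b \<one> \<in> P" using sub c by (auto simp: bracket_one)
    ultimately show False
      using pr ab c unfolding prime_gamma_ideal_def by blast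
  qed
  then have "A \<inter> B = Spec \<Gamma> T u - V \<Gamma> T u (I \<inter> J)"
    unfolding I(2) J(2) V_def by blast
  then show "spec_open \<Gamma> T u (A \<inter> B)" using IJ unfolding spec_open_def by blast
next
  fix \<K> assume K: "\<forall>A\<in>\<K>. spec_open \<Gamma> T u A"
  then obtain J where J: "\<And>A. A \<in> \<K> \<Longrightarrow> gamma_ideal \<Gamma> T u (J A) \<and> A = Spec \<Gamma> T u - V \<Gamma> T u (J A)"
    unfolding spec_open_def by metis
  define G where "G = \<Inter>{I. gamma_ideal \<Gamma> T u I \<and> (\<Union>A\<in>\<K>. J A) \<subseteq> I}"
  have "(\<Union>A\<in>\<K>. J A) \<subseteq> carrier T" using J gamma_ideal_subset by blast
  then have G: "gamma_ideal \<Gamma> T u G"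
    unfolding G_def using gamma_ideal_carrier by (intro gamma_ideal_Inter) auto
  have "G \<subseteq> P \<longleftrightarrow> (\<forall>A\<in>\<K>. J A \<subseteq> P)" if "P \<in> Spec \<Gamma> T u" for P
    using that unfolding G_def Spec_def prime_gamma_ideal_def by blast
  moreover have "\<Union>\<K> = (\<Union>A\<in>\<K>. Spec \<Gamma> T u - V \<Gamma> T u (J A))" using J by auto
  ultimately have "\<Union>\<K> = Spec \<Gamma> T u - V \<Gamma> T u G"
    unfolding V_def by auto
  then show "spec_open \<Gamma> T u (\<Union>\<K>)" using G unfolding spec_open_def by blast
qed

lemma openin_spec_topology: "openin (spec_topology \<Gamma> T u) U \<longleftrightarrow> spec_open \<Gamma> T u U"
  unfolding spec_topology_def by (simp add: istopology_spec_open topology_inverse')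

lemma topspace_spec_topology: "topspace (spec_topology \<Gamma> T u) = Spec \<Gamma> T u"
proof -
  have "V \<Gamma> T u (carrier T) = {}"
    using gamma_ideal_subset by (auto simp: V_def Spec_def prime_gamma_ideal_def)
  then have "spec_open \<Gamma> T u (Spec \<Gamma> T u)"
    using gamma_ideal_carrier unfolding spec_open_def by blast
  then show ?thesis
    unfolding topspace_def openin_spec_topology by (auto simp: spec_open_def)
qed

end

definition spec_map :: "('a, 'm) ring_scheme \<Rightarrow> ('a \<Rightarrow> 'a) \<Rightarrow> 'a set \<Rightarrow> 'a set" where
  "spec_map T \<sigma> P = \<sigma> -` P \<inter> carrier T"


section \<open>Localization at the powers of an element\<close>

definition powers :: "('a, 'm) ring_scheme \<Rightarrow> 'a \<Rightarrow> 'a set" where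
  "powers T f = {f [^]\<^bsub>T\<^esub> n | n::nat. True}"

definition frac_rel :: "('a, 'm) ring_scheme \<Rightarrow> 'a \<Rightarrow> (('a \<times> 'a) \<times> ('a \<times> 'a)) set" where
  "frac_rel T f =
     {((a, s), (b, t)). a \<in> carrier T \<and> b \<in> carrier T \<and> s \<in> powers T f \<and> t \<in> powers T f \<and>
        (\<exists>w\<in>powers T f. w \<otimes>\<^bsub>T\<^esub> a \<otimes>\<^bsub>T\<^esub> t = w \<otimes>\<^bsub>T\<^esub> b \<otimes>\<^bsub>T\<^esub> s)}"

definition frac :: "('a, 'm) ring_scheme \<Rightarrow> 'a \<Rightarrow> 'a \<Rightarrow> 'a \<Rightarrow> ('a \<times> 'a) set" where
  "frac T f a s = frac_rel T f `` {(a, s)}"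

text \<open>
  The sum and the product of two classes are the unions over all representatives; by
  \<open>frac_mult\<close> and \<open>frac_add\<close> below these unions are again single classes.
\<close>

definition localization :: "('a, 'm) ring_scheme \<Rightarrow> 'a \<Rightarrow> ('a \<times> 'a) set ring" where
  "localization T f =
     \<lparr>carrier = (carrier T \<times> powers T f) // frac_rel T f,
      monoid.mult = (\<lambda>X Y. \<Union>(a, s)\<in>X. \<Union>(b, t)\<in>Y. frac T f (a \<otimes>\<^bsub>T\<^esub> b) (s \<otimes>\<^bsub>T\<^esub> t)),
      one = frac T f \<one>\<^bsub>T\<^esub> \<one>\<^bsub>T\<^esub>,
      zero = frac T f \<zero>\<^bsub>T\<^esub> \<one>\<^bsub>T\<^esub>,
      add = (\<lambda>X Y. \<Union>(a, s)\<in>X. \<Union>(b, t)\<in>Y.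
               frac T f (a \<otimes>\<^bsub>T\<^esub> t \<oplus>\<^bsub>T\<^esub> b \<otimes>\<^bsub>T\<^esub> s) (s \<otimes>\<^bsub>T\<^esub> t))\<rparr>"

context csemiring
begin

lemma powers_closed:
  assumes "f \<in> carrier R"
  shows "\<one> \<in> powers R f" "s \<in> powers R f \<Longrightarrow> s \<in> carrier R"
    "s \<in> powers R f \<Longrightarrow> t \<in> powers R f \<Longrightarrow> s \<otimes> t \<in> powers R f"
proof -
  show "\<one> \<in> powers R f" unfolding powers_def by (metis (mono_tags, lifting) mem_Collect_eq nat_pow_0)
  show "s \<in> powers R f \<Longrightarrow> s \<in> carrier R" using assms unfolding powers_def by auto
  show "s \<in> powers R f \<Longrightarrow> t \<in> powers R f \<Longrightarrow> s \<otimes> t \<in> powers R f"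
    using assms unfolding powers_def by (auto simp: nat_pow_mult)
qed

lemma equiv_frac_rel:
  assumes f: "f \<in> carrier R"
  shows "equiv (carrier R \<times> powers R f) (frac_rel R f)"
proof (rule equivI)
  note pc = powers_closed[OF f]
  show "refl_on (carrier R \<times> powers R f) (frac_rel R f)"
    using pc(1) by (auto simp: refl_on_def frac_rel_def)
  show "frac_rel R f \<subseteq> (carrier R \<times> powers R f) \<times> (carrier R \<times> powers R f)"
    by (auto simp: frac_rel_def)
  show "sym (frac_rel R f)"
    by (auto simp: sym_def frac_rel_def) metis
  show "trans (frac_rel R f)"
  proof (rule transI, clarify)
    fix a s b t c r
    assume "((a, s), (b, t)) \<in> frac_rel R f" "((b, t), (c, r)) \<in> frac_rel R f"
    then obtain w w' where *: "a \<in> carrier R" "b \<in> carrier R" "c \<in> carrier R"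
      "s \<in> powers R f" "t \<in> powers R f" "r \<in> powers R f" "w \<in> powers R f" "w' \<in> powers R f"
      "w \<otimes> a \<otimes> t = w \<otimes> b \<otimes> s" "w' \<otimes> b \<otimes> r = w' \<otimes> c \<otimes> t"
      by (auto simp: frac_rel_def)
    note c = pc(2)[OF *(4)] pc(2)[OF *(5)] pc(2)[OF *(6)] pc(2)[OF *(7)] pc(2)[OF *(8)]
    have "(w \<otimes> w' \<otimes> t) \<otimes> a \<otimes> r = (w \<otimes> a \<otimes> t) \<otimes> (w' \<otimes> r)"
      using *(1-8) c by (simp add: m_ac)
    also have "\<dots> = (w' \<otimes> b \<otimes> r) \<otimes> (w \<otimes> s)"
      unfolding *(9) using *(1-8) c by (simp add: m_ac)
    also have "\<dots> = (w \<otimes> w' \<otimes> t) \<otimes> c \<otimes> s"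
      unfolding *(10) using *(1-8) c by (simp add: m_ac)
    finally show "((a, s), (c, r)) \<in> frac_rel R f"
      using * pc(3) by (auto simp: frac_rel_def)
  qed
qed

lemma frac_mult:
  assumes f: "f \<in> carrier R" and ab: "a \<in> carrier R" "b \<in> carrier R"
    and st: "s \<in> powers R f" "t \<in> powers R f"
  shows "frac R f a s \<otimes>\<^bsub>localization R f\<^esub> frac R f b t = frac R f (a \<otimes> b) (s \<otimes> t)"
proof -
  note pc = powers_closed[OF f]
  note E = equiv_frac_rel[OF f]
  have "congruent2 (frac_rel R f) (frac_rel R f) (\<lambda>(a, s) (b, t). frac R f (a \<otimes> b) (s \<otimes> t))"
  proof (rule congruent2_commuteI[OF E], clarify)
    fix a s b t assume "a \<in> carrier R" "s \<in> powers R f" "b \<in> carrier R" "t \<in> powers R f"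
    then show "frac R f (a \<otimes> b) (s \<otimes> t) = frac R f (b \<otimes> a) (t \<otimes> s)"
      using pc(2) by (simp add: m_comm)
  next
    fix p q r assume "r \<in> carrier R \<times> powers R f" "(p, q) \<in> frac_rel R f"
    then obtain c x a s b t w where eq: "r = (c, x)" "p = (a, s)" "q = (b, t)"
      and *: "a \<in> carrier R" "b \<in> carrier R" "c \<in> carrier R"
      "s \<in> powers R f" "t \<in> powers R f" "x \<in> powers R f" "w \<in> powers R f"
      "w \<otimes> a \<otimes> t = w \<otimes> b \<otimes> s"
      by (auto simp: frac_rel_def)
    note cl = pc(2)[OF *(4)] pc(2)[OF *(5)] pc(2)[OF *(6)] pc(2)[OF *(7)]
    have "w \<otimes> (c \<otimes> a) \<otimes> (x \<otimes> t) = (w \<otimes> a \<otimes> t) \<otimes> (c \<otimes> x)"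
      using *(1-7) cl by (simp add: m_ac)
    also have "\<dots> = w \<otimes> (c \<otimes> b) \<otimes> (x \<otimes> s)"
      unfolding *(8) using *(1-7) cl by (simp add: m_ac)
    finally have "((c \<otimes> a, x \<otimes> s), (c \<otimes> b, x \<otimes> t)) \<in> frac_rel R f"
      using * pc(3) by (auto simp: frac_rel_def)
    then show "(case r of (a, s) \<Rightarrow> \<lambda>(b, t). frac R f (a \<otimes> b) (s \<otimes> t)) p =
      (case r of (a, s) \<Rightarrow> \<lambda>(b, t). frac R f (a \<otimes> b) (s \<otimes> t)) q"
      unfolding eq frac_def by (simp add: equiv_class_eq[OF E])
  qed
  from UN_equiv_class2[OF E E this, of "(a, s)" "(b, t)"] show ?thesis
    using ab st by (simp add: localization_def frac_def case_prod_unfold)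
qed

lemma frac_add:
  assumes f: "f \<in> carrier R" and ab: "a \<in> carrier R" "b \<in> carrier R"
    and st: "s \<in> powers R f" "t \<in> powers R f"
  shows "frac R f a s \<oplus>\<^bsub>localization R f\<^esub> frac R f b t = frac R f (a \<otimes> t \<oplus> b \<otimes> s) (s \<otimes> t)"
proof -
  note pc = powers_closed[OF f]
  note E = equiv_frac_rel[OF f]
  have "congruent2 (frac_rel R f) (frac_rel R f)
    (\<lambda>(a, s) (b, t). frac R f (a \<otimes> t \<oplus> b \<otimes> s) (s \<otimes> t))"
  proof (rule congruent2_commuteI[OF E], clarify)
    fix a s b t assume "a \<in> carrier R" "s \<in> powers R f" "b \<in> carrier R" "t \<in> powers R f"
    then show "frac R f (a \<otimes> t \<oplus> b \<otimes> s) (s \<otimes> t) = frac R f (b \<otimes> s \<oplus> a \<otimes> t) (t \<otimes> s)"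
      using pc(2) by (simp add: m_comm a_comm)
  next
    fix p q r assume "r \<in> carrier R \<times> powers R f" "(p, q) \<in> frac_rel R f"
    then obtain c x a s b t w where eq: "r = (c, x)" "p = (a, s)" "q = (b, t)"
      and *: "a \<in> carrier R" "b \<in> carrier R" "c \<in> carrier R"
      "s \<in> powers R f" "t \<in> powers R f" "x \<in> powers R f" "w \<in> powers R f"
      "w \<otimes> a \<otimes> t = w \<otimes> b \<otimes> s"
      by (auto simp: frac_rel_def)
    note cl = pc(2)[OF *(4)] pc(2)[OF *(5)] pc(2)[OF *(6)] pc(2)[OF *(7)]
    have "w \<otimes> (c \<otimes> s \<oplus> a \<otimes> x) \<otimes> (x \<otimes> t) =
        w \<otimes> c \<otimes> s \<otimes> x \<otimes> t \<oplus> (w \<otimes> a \<otimes> t) \<otimes> (x \<otimes> x)"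
      using *(1-7) cl by (simp add: m_ac l_distr r_distr)
    also have "\<dots> = w \<otimes> (c \<otimes> t \<oplus> b \<otimes> x) \<otimes> (x \<otimes> s)"
      unfolding *(8) using *(1-7) cl by (simp add: m_ac l_distr r_distr)
    finally have "((c \<otimes> s \<oplus> a \<otimes> x, x \<otimes> s), (c \<otimes> t \<oplus> b \<otimes> x, x \<otimes> t)) \<in> frac_rel R f"
      using * cl pc(3) by (auto simp: frac_rel_def)
    then show "(case r of (a, s) \<Rightarrow> \<lambda>(b, t). frac R f (a \<otimes> t \<oplus> b \<otimes> s) (s \<otimes> t)) p =
      (case r of (a, s) \<Rightarrow> \<lambda>(b, t). frac R f (a \<otimes> t \<oplus> b \<otimes> s) (s \<otimes> t)) q"
      unfolding eq frac_def by (simp add: equiv_class_eq[OF E])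
  qed
  from UN_equiv_class2[OF E E this, of "(a, s)" "(b, t)"] show ?thesis
    using ab st by (simp add: localization_def frac_def case_prod_unfold)
qed

end

text \<open>
  A homomorphism from \<open>T\<^sub>f\<close> to \<open>T\<^sub>g\<close> compatible with the canonical maps from \<open>T\<close>.
  If it exists (as it does for \<open>D g \<subseteq> D f\<close>), it is unique on the carrier.
\<close>

definition canonical_hom :: "('a, 'm) ring_scheme \<Rightarrow> 'a \<Rightarrow> 'a \<Rightarrow> (('a \<times> 'a) set \<Rightarrow> ('a \<times> 'a) set) \<Rightarrow> bool" where
  "canonical_hom T f g r \<longleftrightarrow>
     r \<in> semiring_hom (localization T f) (localization T g) \<and>
     (\<forall>a\<in>carrier T. r (frac T f a \<one>\<^bsub>T\<^esub>) = frac T g a \<one>\<^bsub>T\<^esub>)"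


section \<open>Sheaves of semirings\<close>

record ('p, 's) presheaf =
  sections :: "'p set \<Rightarrow> 's ring"
  res :: "'p set \<Rightarrow> 'p set \<Rightarrow> 's \<Rightarrow> 's"

definition semiring_presheaf :: "'p topology \<Rightarrow> ('p, 's) presheaf \<Rightarrow> bool" where
  "semiring_presheaf X F \<longleftrightarrow>
     (\<forall>U. openin X U \<longrightarrow> csemiring (sections F U)) \<and>
     (\<forall>U V. openin X U \<and> openin X V \<and> V \<subseteq> U \<longrightarrow>
        res F U V \<in> semiring_hom (sections F U) (sections F V)) \<and>
     (\<forall>U. openin X U \<longrightarrow> (\<forall>s\<in>carrier (sections F U). res F U U s = s)) \<and>
     (\<forall>U V W. openin X U \<and> openin X V \<and> openin X W \<and> W \<subseteq> V \<and> V \<subseteq> U \<longrightarrow>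
        (\<forall>s\<in>carrier (sections F U). res F V W (res F U V s) = res F U W s))"

definition semiring_sheaf :: "'p topology \<Rightarrow> ('p, 's) presheaf \<Rightarrow> bool" where
  "semiring_sheaf X F \<longleftrightarrow>
     semiring_presheaf X F \<and>
     (\<forall>\<U>. (\<forall>U\<in>\<U>. openin X U) \<longrightarrow>
        (\<forall>s\<in>carrier (sections F (\<Union>\<U>)). \<forall>t\<in>carrier (sections F (\<Union>\<U>)).
           (\<forall>U\<in>\<U>. res F (\<Union>\<U>) U s = res F (\<Union>\<U>) U t) \<longrightarrow> s = t) \<and>
        (\<forall>x. (\<forall>U\<in>\<U>. x U \<in> carrier (sections F U)) \<and>
             (\<forall>U\<in>\<U>. \<forall>V\<in>\<U>. res F U (U \<inter> V) (x U) = res F V (U \<inter> V) (x V)) \<longrightarrow>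
           (\<exists>s\<in>carrier (sections F (\<Union>\<U>)). \<forall>U\<in>\<U>. res F (\<Union>\<U>) U s = x U)))"

text \<open>
  In a sheaf of ternary \<open>\<Gamma>\<close>-semirings, \<open>v \<gamma> U\<close> is the unit section belonging to \<open>\<gamma>\<close> over \<open>U\<close>.
\<close>

definition ternary_sheaf ::
  "('g, 'k) monoid_scheme \<Rightarrow> 'p topology \<Rightarrow> ('p, 's) presheaf \<Rightarrow> ('g \<Rightarrow> 'p set \<Rightarrow> 's) \<Rightarrow> bool" where
  "ternary_sheaf \<Gamma> X F v \<longleftrightarrow>
     semiring_sheaf X F \<and>
     (\<forall>U. openin X U \<longrightarrow> ternary_semiring \<Gamma> (sections F U) (\<lambda>\<gamma>. v \<gamma> U)) \<and>
     (\<forall>U V. openin X U \<and> openin X V \<and> V \<subseteq> U \<longrightarrow>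
        (\<forall>\<gamma>\<in>carrier \<Gamma>. res F U V (v \<gamma> U) = v \<gamma> V))"

definition ternary_sheaf_iso ::
  "('g, 'k) monoid_scheme \<Rightarrow> 'p topology \<Rightarrow> ('p, 's) presheaf \<Rightarrow> ('g \<Rightarrow> 'p set \<Rightarrow> 's) \<Rightarrow>
   ('p, 't) presheaf \<Rightarrow> ('g \<Rightarrow> 'p set \<Rightarrow> 't) \<Rightarrow> ('p set \<Rightarrow> 's \<Rightarrow> 't) \<Rightarrow> bool" where
  "ternary_sheaf_iso \<Gamma> X F v G w \<phi> \<longleftrightarrow>
     ternary_sheaf \<Gamma> X F v \<and> ternary_sheaf \<Gamma> X G w \<and>
     (\<forall>U. openin X U \<longrightarrow>
        \<phi> U \<in> ternary_iso \<Gamma> (sections F U) (\<lambda>\<gamma>. v \<gamma> U) (sections G U) (\<lambda>\<gamma>. w \<gamma> U)) \<and>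
     (\<forall>U V. openin X U \<and> openin X V \<and> V \<subseteq> U \<longrightarrow>
        (\<forall>s\<in>carrier (sections F U). \<phi> V (res F U V s) = res G U V (\<phi> U s)))"

definition open_preimage :: "'p topology \<Rightarrow> ('p \<Rightarrow> 'q) \<Rightarrow> 'q set \<Rightarrow> 'p set" where
  "open_preimage X h U = {x \<in> topspace X. h x \<in> U}"

definition direct_image :: "'p topology \<Rightarrow> ('p \<Rightarrow> 'q) \<Rightarrow> ('p, 's) presheaf \<Rightarrow> ('q, 's) presheaf" where
  "direct_image X h F =
     \<lparr>sections = (\<lambda>U. sections F (open_preimage X h U)),
      res = (\<lambda>U V. res F (open_preimage X h U) (open_preimage X h V))\<rparr>"

definition direct_image_units ::
  "'p topology \<Rightarrow> ('p \<Rightarrow> 'q) \<Rightarrow> ('g \<Rightarrow> 'p set \<Rightarrow> 's) \<Rightarrow> 'g \<Rightarrow> 'q set \<Rightarrow> 's" where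
  "direct_image_units X h v \<gamma> U = v \<gamma> (open_preimage X h U)"


section \<open>The structure sheaf\<close>

text \<open>
  The structure sheaf is determined by its defining property only up to unique isomorphism.
  Moreover \<open>D f = D g\<close> does not imply that the sets of fractions \<open>T\<^sub>f\<close> and \<open>T\<^sub>g\<close> are equal.
  The identifications \<open>T\<^sub>f \<cong> \<O>(D f)\<close> are therefore part of the data, as the family \<open>\<iota>\<close>.
\<close>

definition structure_sheaf ::
  "('g, 'k) monoid_scheme \<Rightarrow> ('a, 'm) ring_scheme \<Rightarrow> ('g \<Rightarrow> 'a) \<Rightarrow>
   ('a set, 's) presheaf \<Rightarrow> ('a \<Rightarrow> ('a \<times> 'a) set \<Rightarrow> 's) \<Rightarrow> bool" where
  "structure_sheaf \<Gamma> T u \<O> \<iota> \<longleftrightarrow>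
     semiring_sheaf (spec_topology \<Gamma> T u) \<O> \<and>
     (\<forall>f\<in>carrier T. \<iota> f \<in> semiring_iso (localization T f) (sections \<O> (D \<Gamma> T u f))) \<and>
     (\<forall>f\<in>carrier T. \<forall>g\<in>carrier T. D \<Gamma> T u g \<subseteq> D \<Gamma> T u f \<longrightarrow>
        (\<exists>r. canonical_hom T f g r \<and>
          (\<forall>x\<in>carrier (localization T f).
             res \<O> (D \<Gamma> T u f) (D \<Gamma> T u g) (\<iota> f x) = \<iota> g (r x))))"

text \<open>
  The unit section over \<open>U\<close> is the image of \<open>u \<gamma>\<close> under \<open>T \<rightarrow> T\<^sub>1 \<cong> \<O>(D 1) \<rightarrow> \<O>(U)\<close>, where \<open>D 1\<close> is
  the whole spectrum.
\<close>

definition unit_section ::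
  "('g, 'k) monoid_scheme \<Rightarrow> ('a, 'm) ring_scheme \<Rightarrow> ('g \<Rightarrow> 'a) \<Rightarrow>
   ('a set, 's) presheaf \<Rightarrow> ('a \<Rightarrow> ('a \<times> 'a) set \<Rightarrow> 's) \<Rightarrow> 'g \<Rightarrow> 'a set set \<Rightarrow> 's" where
  "unit_section \<Gamma> T u \<O> \<iota> \<gamma> U =
     res \<O> (D \<Gamma> T u \<one>\<^bsub>T\<^esub>) U (\<iota> \<one>\<^bsub>T\<^esub> (frac T \<one>\<^bsub>T\<^esub> (u \<gamma>) \<one>\<^bsub>T\<^esub>))"

text \<open>
  What it means for a family of maps \<open>\<phi>\<close> from \<open>\<O>\<close> to its direct image to be induced by \<open>\<sigma>\<close>:
  over \<open>D f\<close> it is the map \<open>T\<^sub>f \<rightarrow> T\<^bsub>\<sigma> f\<^esub>\<close> given by \<open>a/s \<mapsto> \<sigma>(a)/\<sigma>(s)\<close>,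
  because the preimage of \<open>D f\<close> under \<open>P \<mapsto> \<sigma>\<inverse>(P)\<close> is \<open>D (\<sigma> f)\<close>.
\<close>

definition induced_by ::
  "('g, 'k) monoid_scheme \<Rightarrow> ('a, 'm) ring_scheme \<Rightarrow> ('g \<Rightarrow> 'a) \<Rightarrow>
   ('a \<Rightarrow> ('a \<times> 'a) set \<Rightarrow> 's) \<Rightarrow> ('a \<Rightarrow> 'a) \<Rightarrow> ('a set set \<Rightarrow> 's \<Rightarrow> 's) \<Rightarrow> bool" where
  "induced_by \<Gamma> T u \<iota> \<sigma> \<phi> \<longleftrightarrow>
     (\<forall>f\<in>carrier T. \<forall>a\<in>carrier T. \<forall>s\<in>powers T f.
        \<phi> (D \<Gamma> T u f) (\<iota> f (frac T f a s)) = \<iota> (\<sigma> f) (frac T (\<sigma> f) (\<sigma> a) (\<sigma> s)))"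

end

theory Submission
  imports Defs
begin

text \<open>
  An automorphism \<open>\<sigma>\<close> transports all the data from which the spectrum and its structure sheaf are
  made. It pulls prime \<open>\<Gamma>\<close>-ideals back to prime \<open>\<Gamma>\<close>-ideals because it commutes with the
  brackets, and \<open>\<sigma>(f) \<in> P\<close> iff \<open>f \<in> \<sigma>\<inverse>(P)\<close>, so the preimage of \<open>D f\<close> under
  \<open>\<sigma>\<^sup>*\<close> is \<open>D (\<sigma> f)\<close>. Hence \<open>\<sigma>\<^sup>*\<close> is continuous; the same holds for \<open>\<sigma>\<inverse>\<close>, whose
  pullback is the inverse of \<open>\<sigma>\<^sup>*\<close> (\<open>homeomorphic_spec_map\<close>).

  Over a principal open \<open>D f\<close> the map of sheaves has to be \<open>T\<^sub>f \<rightarrow> T\<^bsub>\<sigma> f\<^esub>\<close>,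
  \<open>a/s \<mapsto> \<sigma>(a)/\<sigma>(s)\<close>, which is an isomorphism (\<open>frac_map_iso\<close>). The essential point is that
  these maps commute with restriction. This also shows that they depend only on the open set
  \<open>D f\<close> and not on its generator \<open>f\<close> (\<open>basis_map_\<iota>\<close>). It holds because a homomorphism on \<open>T\<^sub>f\<close>
  is determined by its values on the fractions \<open>a/1\<close> (\<open>localization_hom_eq\<close>), and both ways round the
  square send \<open>a/1\<close> to \<open>\<sigma>(a)/1\<close> (\<open>res_\<iota>_frac_map\<close>).

  The principal opens form a basis closed under intersections, and isomorphisms between two sheaves
  given over such a basis, compatibly with restriction, extend to all opens by gluing: the extension
  of a section \<open>s\<close> over \<open>U\<close> is the only section whose restriction to each basic \<open>B \<subseteq> U\<close> is the image
  of the restriction of \<open>s\<close> (\<open>ext_props\<close>, \<open>ext_eqI\<close>). That characterization transfers every property from the basis to arbitrary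
  opens: it makes the extension a homomorphism (\<open>ext_hom\<close>), natural (\<open>ext_natural\<close>), bijective
  (\<open>ext_bij\<close>) and, because \<open>\<sigma>\<close> fixes each \<open>u \<gamma>\<close>, compatible with the unit sections
  (\<open>ext_unit_section\<close>). The bracket is a product of three sections and a unit section, so it is
  preserved.
\<close>


section \<open>Semiring homomorphisms\<close>

lemma semiring_homD:
  assumes "h \<in> semiring_hom R S"
  shows "x \<in> carrier R \<Longrightarrow> h x \<in> carrier S"
    and "x \<in> carrier R \<Longrightarrow> y \<in> carrier R \<Longrightarrow> h (x \<otimes>\<^bsub>R\<^esub> y) = h x \<otimes>\<^bsub>S\<^esub> h y"
    and "x \<in> carrier R \<Longrightarrow> y \<in> carrier R \<Longrightarrow> h (x \<oplus>\<^bsub>R\<^esub> y) = h x \<oplus>\<^bsub>S\<^esub> h y"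
    and "h \<one>\<^bsub>R\<^esub> = \<one>\<^bsub>S\<^esub>"
    and "h \<zero>\<^bsub>R\<^esub> = \<zero>\<^bsub>S\<^esub>"
  using assms by (auto simp: semiring_hom_def ring_hom_def)

lemma semiring_homI:
  assumes "\<And>x. x \<in> carrier R \<Longrightarrow> h x \<in> carrier S"
    and "\<And>x y. x \<in> carrier R \<Longrightarrow> y \<in> carrier R \<Longrightarrow> h (x \<otimes>\<^bsub>R\<^esub> y) = h x \<otimes>\<^bsub>S\<^esub> h y"
    and "\<And>x y. x \<in> carrier R \<Longrightarrow> y \<in> carrier R \<Longrightarrow> h (x \<oplus>\<^bsub>R\<^esub> y) = h x \<oplus>\<^bsub>S\<^esub> h y"
    and "h \<one>\<^bsub>R\<^esub> = \<one>\<^bsub>S\<^esub>"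
    and "h \<zero>\<^bsub>R\<^esub> = \<zero>\<^bsub>S\<^esub>"
  shows "h \<in> semiring_hom R S"
  using assms by (auto simp: semiring_hom_def ring_hom_def)

lemma semiring_hom_comp:
  assumes "h \<in> semiring_hom R S" "k \<in> semiring_hom S Q"
  shows "(\<lambda>x. k (h x)) \<in> semiring_hom R Q"
  using semiring_homD[OF assms(1)] semiring_homD[OF assms(2)] by (intro semiring_homI) auto

lemma semiring_isoD:
  assumes "h \<in> semiring_iso R S"
  shows "h \<in> semiring_hom R S" "bij_betw h (carrier R) (carrier S)"
  using assms by (auto simp: semiring_iso_def)

lemma semiring_iso_comp:
  assumes "h \<in> semiring_iso R S" "k \<in> semiring_iso S Q"
  shows "(\<lambda>x. k (h x)) \<in> semiring_iso R Q"
  using semiring_hom_comp[of h R S k Q] assms bij_betw_trans[of h "carrier R" "carrier S" k "carrier Q"]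
  by (auto simp: semiring_iso_def comp_def)

text \<open>
  The map with \<open>h x \<mapsto> k x\<close> is \<open>k \<circ> h\<inverse>\<close>; stating the result for any such \<open>p\<close> makes it
  available for maps that are only known through their values on the image of \<open>h\<close>.
\<close>

lemma semiring_iso_factor:
  assumes h: "h \<in> semiring_iso R S" and k: "k \<in> semiring_iso R Q"
    and p: "\<And>x. x \<in> carrier R \<Longrightarrow> p (h x) = k x"
    and one: "\<one>\<^bsub>R\<^esub> \<in> carrier R" and zero: "\<zero>\<^bsub>R\<^esub> \<in> carrier R"
    and mult: "\<And>x y. x \<in> carrier R \<Longrightarrow> y \<in> carrier R \<Longrightarrow> x \<otimes>\<^bsub>R\<^esub> y \<in> carrier R"
    and add: "\<And>x y. x \<in> carrier R \<Longrightarrow> y \<in> carrier R \<Longrightarrow> x \<oplus>\<^bsub>R\<^esub> y \<in> carrier R"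
  shows "p \<in> semiring_iso S Q"
proof -
  note hD = semiring_homD[OF semiring_isoD(1)[OF h]]
  note kD = semiring_homD[OF semiring_isoD(1)[OF k]]
  have img: "carrier S = h ` carrier R"
    using semiring_isoD(2)[OF h] by (simp add: bij_betw_def)
  have "p \<in> semiring_hom S Q"
  proof (rule semiring_homI)
    fix x y assume "x \<in> carrier S" "y \<in> carrier S"
    then obtain a b where ab: "a \<in> carrier R" "b \<in> carrier R" "x = h a" "y = h b"
      using img by auto
    show "p (x \<otimes>\<^bsub>S\<^esub> y) = p x \<otimes>\<^bsub>Q\<^esub> p y"
      using ab mult p kD(2) by (simp flip: hD(2))
    show "p (x \<oplus>\<^bsub>S\<^esub> y) = p x \<oplus>\<^bsub>Q\<^esub> p y"
      using ab add p kD(3) by (simp flip: hD(3))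
  next
    show "p x \<in> carrier Q" if "x \<in> carrier S" for x using that img p kD(1) by auto
    show "p \<one>\<^bsub>S\<^esub> = \<one>\<^bsub>Q\<^esub>" using p[OF one] hD(4) kD(4) by simp
    show "p \<zero>\<^bsub>S\<^esub> = \<zero>\<^bsub>Q\<^esub>" using p[OF zero] hD(5) kD(5) by simp
  qed
  moreover have "bij_betw p (carrier S) (carrier Q)"
  proof -
    have "bij_betw (p \<circ> h) (carrier R) (carrier Q)"
      using semiring_isoD(2)[OF k] p by (simp cong: bij_betw_cong)
    then show ?thesis using bij_betw_comp_iff[OF semiring_isoD(2)[OF h]] by blast
  qed
  ultimately show ?thesis by (simp add: semiring_iso_def)
qed

text \<open>
  A homomorphism maps units to units. Applied to \<open>T \<rightarrow> \<O>(U)\<close>, this makes the sections of the structure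
  sheaf into ternary \<open>\<Gamma>\<close>-semirings.
\<close>

lemma (in ternary_semiring) ternary_semiring_hom_image:
  assumes S: "csemiring S" and h: "h \<in> semiring_hom T S"
  shows "ternary_semiring \<Gamma> S (\<lambda>\<gamma>. h (u \<gamma>))"
proof -
  interpret S: csemiring S by fact
  note hD = semiring_homD[OF h]
  have "h x \<in> Units S" if x: "x \<in> Units T" for x
  proof -
    obtain y where "x \<in> carrier T" "y \<in> carrier T" "x \<otimes> y = \<one>" "y \<otimes> x = \<one>"
      using x by (auto simp: Units_def)
    then have "h x \<in> carrier S" "h y \<in> carrier S"
      "h x \<otimes>\<^bsub>S\<^esub> h y = \<one>\<^bsub>S\<^esub>" "h y \<otimes>\<^bsub>S\<^esub> h x = \<one>\<^bsub>S\<^esub>"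
      by (simp_all add: hD flip: hD(2))
    then show ?thesis by (auto simp: Units_def)
  qed
  moreover have "u \<gamma> \<in> Units T" if "\<gamma> \<in> carrier \<Gamma>" for \<gamma>
    using hom_in_carrier[OF u_hom that] by (simp add: units_of_def)
  ultimately have "(\<lambda>\<gamma>. h (u \<gamma>)) \<in> hom \<Gamma> (units_of S)"
    using hom_mult[OF u_hom] u_closed hD(2) by (auto simp: hom_def units_of_def)
  then show ?thesis
    by (intro ternary_semiring.intro ternary_semiring_axioms.intro S \<Gamma>.comm_group_axioms)
qed

lemma ternary_iso_bracket:
  assumes "ternary_semiring \<Gamma> R v" and h: "h \<in> ternary_iso \<Gamma> R v S w" and \<gamma>: "\<gamma> \<in> carrier \<Gamma>"
    and abc: "a \<in> carrier R" "b \<in> carrier R" "c \<in> carrier R"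
  shows "h (bracket R v \<gamma> a b c) = bracket S w \<gamma> (h a) (h b) (h c)"
proof -
  interpret ternary_semiring \<Gamma> R v by fact
  have "h \<in> semiring_hom R S" "h (v \<gamma>) = w \<gamma>"
    using h \<gamma> by (auto simp: ternary_iso_def semiring_iso_def)
  then show ?thesis using abc u_closed[OF \<gamma>] by (simp add: bracket_def semiring_homD)
qed


section \<open>Semirings of fractions\<close>

context csemiring
begin

lemma frac_in_localization:
  "a \<in> carrier R \<Longrightarrow> s \<in> powers R f \<Longrightarrow> frac R f a s \<in> carrier (localization R f)"
  by (auto simp: localization_def frac_def intro: quotientI)

lemma localization_cases:
  assumes "x \<in> carrier (localization R f)"
  obtains a s where "a \<in> carrier R" "s \<in> powers R f" "x = frac R f a s"
  using assms by (auto simp: localization_def frac_def elim!: quotientE)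

lemma frac_eqI:
  assumes f: "f \<in> carrier R" and "a \<in> carrier R" "b \<in> carrier R"
    and "s \<in> powers R f" "t \<in> powers R f" and "a \<otimes> t = b \<otimes> s"
  shows "frac R f a s = frac R f b t"
proof -
  have "((a, s), (b, t)) \<in> frac_rel R f"
    using assms powers_closed[OF f] by (auto simp: frac_rel_def intro!: bexI[of _ \<one>])
  then show ?thesis
    unfolding frac_def by (rule equiv_class_eq[OF equiv_frac_rel[OF f]])
qed

lemma localization_closed:
  assumes f: "f \<in> carrier R"
  shows "\<one>\<^bsub>localization R f\<^esub> \<in> carrier (localization R f)"
    and "\<zero>\<^bsub>localization R f\<^esub> \<in> carrier (localization R f)"
    and "\<lbrakk>x \<in> carrier (localization R f); y \<in> carrier (localization R f)\<rbrakk> \<Longrightarrow>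
           x \<otimes>\<^bsub>localization R f\<^esub> y \<in> carrier (localization R f)"
    and "\<lbrakk>x \<in> carrier (localization R f); y \<in> carrier (localization R f)\<rbrakk> \<Longrightarrow>
           x \<oplus>\<^bsub>localization R f\<^esub> y \<in> carrier (localization R f)"
proof -
  note pc = powers_closed[OF f]
  show "\<one>\<^bsub>localization R f\<^esub> \<in> carrier (localization R f)"
    "\<zero>\<^bsub>localization R f\<^esub> \<in> carrier (localization R f)"
    using frac_in_localization[OF _ pc(1)] by (simp_all add: localization_def)
  assume "x \<in> carrier (localization R f)" "y \<in> carrier (localization R f)"
  then obtain a s b t where *: "a \<in> carrier R" "s \<in> powers R f" "x = frac R f a s"
    "b \<in> carrier R" "t \<in> powers R f" "y = frac R f b t"
    by (elim localization_cases)
  show "x \<otimes>\<^bsub>localization R f\<^esub> y \<in> carrier (localization R f)"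
    using * f pc by (simp add: frac_mult frac_in_localization)
  show "x \<oplus>\<^bsub>localization R f\<^esub> y \<in> carrier (localization R f)"
    using * f pc by (simp add: frac_add frac_in_localization)
qed

lemma canonical_map_hom:
  assumes f: "f \<in> carrier R"
  shows "(\<lambda>a. frac R f a \<one>) \<in> semiring_hom R (localization R f)"
proof (rule semiring_homI)
  note pc = powers_closed(1)[OF f]
  show "frac R f a \<one> \<in> carrier (localization R f)" if "a \<in> carrier R" for a
    using that pc by (rule frac_in_localization)
  show "frac R f (a \<otimes> b) \<one> = frac R f a \<one> \<otimes>\<^bsub>localization R f\<^esub> frac R f b \<one>"
    "frac R f (a \<oplus> b) \<one> = frac R f a \<one> \<oplus>\<^bsub>localization R f\<^esub> frac R f b \<one>"
    if "a \<in> carrier R" "b \<in> carrier R" for a b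
    using that f pc by (simp_all add: frac_mult frac_add)
qed (simp_all add: localization_def)

text \<open>
  The fraction \<open>a/s\<close> is the product of \<open>a/1\<close> with the inverse of \<open>s/1\<close>, and homomorphisms preserve
  inverses, which are unique in a commutative monoid.
\<close>

lemma localization_hom_eq:
  assumes f: "f \<in> carrier R" and S: "csemiring S"
    and h: "h \<in> semiring_hom (localization R f) S" and k: "k \<in> semiring_hom (localization R f) S"
    and eq: "\<And>a. a \<in> carrier R \<Longrightarrow> h (frac R f a \<one>) = k (frac R f a \<one>)"
    and x: "x \<in> carrier (localization R f)"
  shows "h x = k x"
proof -
  interpret S: csemiring S by fact
  note pc = powers_closed[OF f]
  obtain a s where as: "a \<in> carrier R" "s \<in> powers R f" and x_eq: "x = frac R f a s"
    using x by (rule localization_cases)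
  have s: "s \<in> carrier R" using as pc by blast
  note fr = frac_in_localization[OF as(1) pc(1)] frac_in_localization[OF s pc(1)]
    frac_in_localization[OF one_closed as(2)]
  have split: "x = frac R f a \<one> \<otimes>\<^bsub>localization R f\<^esub> frac R f \<one> s"
    using as s f pc by (simp add: x_eq frac_mult)
  have "frac R f s \<one> \<otimes>\<^bsub>localization R f\<^esub> frac R f \<one> s = frac R f \<one> \<one>"
    using as s f pc by (simp add: frac_mult) (rule frac_eqI, auto)
  then have inv: "frac R f s \<one> \<otimes>\<^bsub>localization R f\<^esub> frac R f \<one> s = \<one>\<^bsub>localization R f\<^esub>"
    by (simp add: localization_def)
  have "h (frac R f s \<one>) \<otimes>\<^bsub>S\<^esub> h (frac R f \<one> s) = \<one>\<^bsub>S\<^esub>"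
    "h (frac R f s \<one>) \<otimes>\<^bsub>S\<^esub> k (frac R f \<one> s) = \<one>\<^bsub>S\<^esub>"
    using inv fr semiring_homD[OF h] semiring_homD[OF k] eq[OF s] by metis+
  then have "h (frac R f \<one> s) = k (frac R f \<one> s)"
    using S.inv_unique[of "h (frac R f \<one> s)" "h (frac R f s \<one>)" "k (frac R f \<one> s)"]
      fr semiring_homD(1)[OF h] semiring_homD(1)[OF k] by (simp add: S.m_comm)
  then show ?thesis
    using split fr eq[OF as(1)] semiring_homD(2)[OF h] semiring_homD(2)[OF k] by simp
qed

end

text \<open>
  For an automorphism \<open>\<sigma>\<close>, a class of fractions is carried by \<open>\<sigma> \<times> \<sigma>\<close> onto a whole class of
  fractions, so the map \<open>a/s \<mapsto> \<sigma>(a)/\<sigma>(s)\<close> can be defined as a set-theoretic image, without a choice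
  of representatives.
\<close>

definition frac_map :: "('a \<Rightarrow> 'a) \<Rightarrow> ('a \<times> 'a) set \<Rightarrow> ('a \<times> 'a) set" where
  "frac_map \<sigma> X = map_prod \<sigma> \<sigma> ` X"

locale csemiring_automorphism = csemiring R for R :: "('a, 'm) ring_scheme" (structure) +
  fixes \<sigma> :: "'a \<Rightarrow> 'a"
  assumes iso: "\<sigma> \<in> semiring_iso R R"
begin

lemmas hom = semiring_homD[OF semiring_isoD(1)[OF iso]]
lemmas bij = semiring_isoD(2)[OF iso]

lemma eq_iff: "a \<in> carrier R \<Longrightarrow> b \<in> carrier R \<Longrightarrow> \<sigma> a = \<sigma> b \<longleftrightarrow> a = b"
  using bij by (auto simp: bij_betw_def inj_on_def)

lemma powers_image:
  assumes f: "f \<in> carrier R"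
  shows "powers R (\<sigma> f) = \<sigma> ` powers R f"
proof -
  have "\<sigma> (f [^] n) = \<sigma> f [^] n" for n :: nat
    using f by (induction n) (auto simp: hom)
  then show ?thesis by (auto simp: powers_def image_Collect) metis+
qed

lemma frac_rel_image:
  assumes f: "f \<in> carrier R" and "a \<in> carrier R" "b \<in> carrier R" "s \<in> powers R f" "t \<in> powers R f"
  shows "((\<sigma> a, \<sigma> s), (\<sigma> b, \<sigma> t)) \<in> frac_rel R (\<sigma> f) \<longleftrightarrow> ((a, s), (b, t)) \<in> frac_rel R f"
proof -
  note pc = powers_closed[OF f]
  have "\<sigma> w \<otimes> \<sigma> a \<otimes> \<sigma> t = \<sigma> w \<otimes> \<sigma> b \<otimes> \<sigma> s \<longleftrightarrow> w \<otimes> a \<otimes> t = w \<otimes> b \<otimes> s"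
    if "w \<in> powers R f" for w
    using assms that pc by (simp add: eq_iff flip: hom(2))
  then show ?thesis
    using assms by (auto simp: frac_rel_def powers_image hom)
qed

lemma frac_map_frac:
  assumes f: "f \<in> carrier R" and a: "a \<in> carrier R" and s: "s \<in> powers R f"
  shows "frac_map \<sigma> (frac R f a s) = frac R (\<sigma> f) (\<sigma> a) (\<sigma> s)"
proof -
  have rel: "((\<sigma> a, \<sigma> s), y) \<in> frac_rel R (\<sigma> f) \<longleftrightarrow>
      (\<exists>b t. ((a, s), (b, t)) \<in> frac_rel R f \<and> y = (\<sigma> b, \<sigma> t))" (is "?l \<longleftrightarrow> ?r") for y
  proof
    assume l: ?l
    then have "fst y \<in> \<sigma> ` carrier R" "snd y \<in> \<sigma> ` powers R f"
      using bij powers_image[OF f] by (auto simp: frac_rel_def bij_betw_def)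
    then obtain b t where "b \<in> carrier R" "t \<in> powers R f" "y = (\<sigma> b, \<sigma> t)"
      by (metis imageE prod.collapse)
    with l show ?r using frac_rel_image[OF f a _ s] by auto
  next
    assume ?r
    then show ?l using frac_rel_image[OF f a _ s] by (auto simp: frac_rel_def)
  qed
  have "frac_rel R (\<sigma> f) `` {(\<sigma> a, \<sigma> s)} = map_prod \<sigma> \<sigma> ` (frac_rel R f `` {(a, s)})"
    by (intro Set.set_eqI) (simp add: rel image_iff Bex_def)
  then show ?thesis by (simp add: frac_map_def frac_def)
qed

lemma frac_map_iso:
  assumes f: "f \<in> carrier R"
  shows "frac_map \<sigma> \<in> semiring_iso (localization R f) (localization R (\<sigma> f))"
proof -
  note pc = powers_closed[OF f]
  note img = powers_image[OF f]
  have \<sigma>f: "\<sigma> f \<in> carrier R" using f by (rule hom(1))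
  have h: "frac_map \<sigma> \<in> semiring_hom (localization R f) (localization R (\<sigma> f))"
  proof (rule semiring_homI)
    fix x y assume "x \<in> carrier (localization R f)" "y \<in> carrier (localization R f)"
    then obtain a s b t where *: "a \<in> carrier R" "s \<in> powers R f" "x = frac R f a s"
      "b \<in> carrier R" "t \<in> powers R f" "y = frac R f b t"
      by (elim localization_cases)
    show "frac_map \<sigma> (x \<otimes>\<^bsub>localization R f\<^esub> y) =
        frac_map \<sigma> x \<otimes>\<^bsub>localization R (\<sigma> f)\<^esub> frac_map \<sigma> y"
      using * f \<sigma>f pc by (simp add: frac_mult frac_map_frac hom img)
    show "frac_map \<sigma> (x \<oplus>\<^bsub>localization R f\<^esub> y) =
        frac_map \<sigma> x \<oplus>\<^bsub>localization R (\<sigma> f)\<^esub> frac_map \<sigma> y"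
      using * f \<sigma>f pc by (simp add: frac_add frac_map_frac hom img)
  next
    show "frac_map \<sigma> x \<in> carrier (localization R (\<sigma> f))" if "x \<in> carrier (localization R f)" for x
      using that f by (elim localization_cases) (simp add: frac_map_frac frac_in_localization hom img)
    show "frac_map \<sigma> \<one>\<^bsub>localization R f\<^esub> = \<one>\<^bsub>localization R (\<sigma> f)\<^esub>"
      "frac_map \<sigma> \<zero>\<^bsub>localization R f\<^esub> = \<zero>\<^bsub>localization R (\<sigma> f)\<^esub>"
      using f pc by (simp_all add: localization_def frac_map_frac hom)
  qed
  have "bij_betw (frac_map \<sigma>) (carrier (localization R f)) (carrier (localization R (\<sigma> f)))"
    unfolding bij_betw_def
  proof
    have sub: "x \<subseteq> carrier R \<times> carrier R" if "x \<in> carrier (localization R f)" for x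
      using that pc by (elim localization_cases) (auto simp: frac_def frac_rel_def)
    have "inj_on (map_prod \<sigma> \<sigma>) (carrier R \<times> carrier R)"
      using bij by (auto simp: bij_betw_def intro: map_prod_inj_on)
    then show "inj_on (frac_map \<sigma>) (carrier (localization R f))"
      using sub by (auto intro!: inj_onI simp: frac_map_def inj_on_image_eq_iff)
    show "frac_map \<sigma> ` carrier (localization R f) = carrier (localization R (\<sigma> f))"
    proof
      show "frac_map \<sigma> ` carrier (localization R f) \<subseteq> carrier (localization R (\<sigma> f))"
        using semiring_homD(1)[OF h] by blast
      show "carrier (localization R (\<sigma> f)) \<subseteq> frac_map \<sigma> ` carrier (localization R f)"
      proof
        fix y assume "y \<in> carrier (localization R (\<sigma> f))"
        then obtain a s where "a \<in> \<sigma> ` carrier R" "s \<in> \<sigma> ` powers R f" "y = frac R (\<sigma> f) a s"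
          using bij by (elim localization_cases) (simp add: img bij_betw_def)
        then obtain b t where "b \<in> carrier R" "t \<in> powers R f" "y = frac R (\<sigma> f) (\<sigma> b) (\<sigma> t)"
          by blast
        then show "y \<in> frac_map \<sigma> ` carrier (localization R f)"
          using f by (simp add: frac_in_localization flip: frac_map_frac)
      qed
    qed
  qed
  with h show ?thesis by (simp add: semiring_iso_def)
qed

end


section \<open>Gluing isomorphisms of sheaves over a basis\<close>

lemma semiring_sheafD:
  assumes "semiring_sheaf X F"
  shows "openin X U \<Longrightarrow> csemiring (sections F U)"
    and "openin X U \<Longrightarrow> openin X W \<Longrightarrow> W \<subseteq> U \<Longrightarrow> res F U W \<in> semiring_hom (sections F U) (sections F W)"
    and "openin X U \<Longrightarrow> s \<in> carrier (sections F U) \<Longrightarrow> res F U U s = s"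
    and "openin X U \<Longrightarrow> openin X W \<Longrightarrow> openin X W' \<Longrightarrow> W' \<subseteq> W \<Longrightarrow> W \<subseteq> U \<Longrightarrow>
      s \<in> carrier (sections F U) \<Longrightarrow> res F W W' (res F U W s) = res F U W' s"
    and "(\<And>U. U \<in> \<U> \<Longrightarrow> openin X U) \<Longrightarrow> s \<in> carrier (sections F (\<Union>\<U>)) \<Longrightarrow>
      t \<in> carrier (sections F (\<Union>\<U>)) \<Longrightarrow>
      (\<And>U. U \<in> \<U> \<Longrightarrow> res F (\<Union>\<U>) U s = res F (\<Union>\<U>) U t) \<Longrightarrow> s = t"
    and "(\<And>U. U \<in> \<U> \<Longrightarrow> openin X U) \<Longrightarrow> (\<And>U. U \<in> \<U> \<Longrightarrow> x U \<in> carrier (sections F U)) \<Longrightarrow>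
      (\<And>U W. U \<in> \<U> \<Longrightarrow> W \<in> \<U> \<Longrightarrow> res F U (U \<inter> W) (x U) = res F W (U \<inter> W) (x W)) \<Longrightarrow>
      \<exists>s\<in>carrier (sections F (\<Union>\<U>)). \<forall>U\<in>\<U>. res F (\<Union>\<U>) U s = x U"
proof -
  note sheaf = assms[unfolded semiring_sheaf_def]
  note presheaf = sheaf[THEN conjunct1, unfolded semiring_presheaf_def]
  show "openin X U \<Longrightarrow> csemiring (sections F U)"
    using presheaf[THEN conjunct1] by blast
  show "openin X U \<Longrightarrow> openin X W \<Longrightarrow> W \<subseteq> U \<Longrightarrow> res F U W \<in> semiring_hom (sections F U) (sections F W)"
    using presheaf[THEN conjunct2, THEN conjunct1] by blast
  show "openin X U \<Longrightarrow> s \<in> carrier (sections F U) \<Longrightarrow> res F U U s = s"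
    using presheaf[THEN conjunct2, THEN conjunct2, THEN conjunct1] by blast
  show "openin X U \<Longrightarrow> openin X W \<Longrightarrow> openin X W' \<Longrightarrow> W' \<subseteq> W \<Longrightarrow> W \<subseteq> U \<Longrightarrow>
      s \<in> carrier (sections F U) \<Longrightarrow> res F W W' (res F U W s) = res F U W' s"
    using presheaf[THEN conjunct2, THEN conjunct2, THEN conjunct2] by blast
next
  assume "\<And>U. U \<in> \<U> \<Longrightarrow> openin X U"
  then have "\<forall>U\<in>\<U>. openin X U" by blast
  note gluing = assms[unfolded semiring_sheaf_def, THEN conjunct2, THEN spec[of _ \<U>], THEN mp, OF this]
  show "s = t" if "s \<in> carrier (sections F (\<Union>\<U>))" "t \<in> carrier (sections F (\<Union>\<U>))"
    "\<And>U. U \<in> \<U> \<Longrightarrow> res F (\<Union>\<U>) U s = res F (\<Union>\<U>) U t"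
    using gluing[THEN conjunct1] that by simp
  show "\<exists>s\<in>carrier (sections F (\<Union>\<U>)). \<forall>U\<in>\<U>. res F (\<Union>\<U>) U s = x U"
    if "\<And>U. U \<in> \<U> \<Longrightarrow> x U \<in> carrier (sections F U)"
      "\<And>U W. U \<in> \<U> \<Longrightarrow> W \<in> \<U> \<Longrightarrow> res F U (U \<inter> W) (x U) = res F W (U \<inter> W) (x W)"
    by (rule gluing[THEN conjunct2, THEN spec[of _ x], THEN mp]) (use that in auto)
qed

text \<open>
  The basis \<open>\<B>\<close> is closed under intersections, so that sections over members of \<open>\<B>\<close> can be compared
  on overlaps by means of \<open>\<psi>\<close> itself.
\<close>

locale basis_isomorphism =
  fixes X :: "'p topology" and F :: "('p, 's) presheaf" and G :: "('p, 't) presheaf"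
    and \<B> :: "'p set set" and \<psi> :: "'p set \<Rightarrow> 's \<Rightarrow> 't"
  assumes F: "semiring_sheaf X F" and G: "semiring_sheaf X G"
    and basis_open: "\<And>B. B \<in> \<B> \<Longrightarrow> openin X B"
    and basis_Int: "\<And>A B. A \<in> \<B> \<Longrightarrow> B \<in> \<B> \<Longrightarrow> A \<inter> B \<in> \<B>"
    and basis_Union: "\<And>U. openin X U \<Longrightarrow> \<Union>{B \<in> \<B>. B \<subseteq> U} = U"
    and iso: "\<And>B. B \<in> \<B> \<Longrightarrow> \<psi> B \<in> semiring_iso (sections F B) (sections G B)"
    and natural: "\<And>A B s. \<lbrakk>A \<in> \<B>; B \<in> \<B>; A \<subseteq> B; s \<in> carrier (sections F B)\<rbrakk> \<Longrightarrow>
      \<psi> A (res F B A s) = res G B A (\<psi> B s)"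
begin

lemma basis_separated:
  assumes H: "semiring_sheaf X H" and U: "openin X U"
    and s: "s \<in> carrier (sections H U)" and t: "t \<in> carrier (sections H U)"
    and eq: "\<And>B. B \<in> \<B> \<Longrightarrow> B \<subseteq> U \<Longrightarrow> res H U B s = res H U B t"
  shows "s = t"
  using semiring_sheafD(5)[OF H, of "{B \<in> \<B>. B \<subseteq> U}" s t] s t eq basis_open
  by (auto simp: basis_Union[OF U])

text \<open>
  Compatibility is required for nested members of the basis only: for two members \<open>A\<close> and \<open>B\<close>, both
  restrictions to \<open>A \<inter> B \<in> \<B>\<close> are then equal to \<open>x (A \<inter> B)\<close>.
\<close>

lemma basis_glue:
  assumes H: "semiring_sheaf X H" and U: "openin X U"
    and x: "\<And>B. B \<in> \<B> \<Longrightarrow> B \<subseteq> U \<Longrightarrow> x B \<in> carrier (sections H B)"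
    and compat: "\<And>A B. A \<in> \<B> \<Longrightarrow> B \<in> \<B> \<Longrightarrow> A \<subseteq> B \<Longrightarrow> B \<subseteq> U \<Longrightarrow> res H B A (x B) = x A"
  obtains s where "s \<in> carrier (sections H U)" "\<And>B. B \<in> \<B> \<Longrightarrow> B \<subseteq> U \<Longrightarrow> res H U B s = x B"
proof -
  have "res H A (A \<inter> B) (x A) = res H B (A \<inter> B) (x B)"
    if "A \<in> \<B>" "A \<subseteq> U" "B \<in> \<B>" "B \<subseteq> U" for A B
    using compat[of "A \<inter> B" A] compat[of "A \<inter> B" B] that basis_Int by auto
  then have "\<exists>s\<in>carrier (sections H (\<Union>{B \<in> \<B>. B \<subseteq> U})).
      \<forall>B\<in>{B \<in> \<B>. B \<subseteq> U}. res H (\<Union>{B \<in> \<B>. B \<subseteq> U}) B s = x B"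
    using x basis_open by (intro semiring_sheafD(6)[OF H]) auto
  then show thesis
    unfolding basis_Union[OF U] using that by blast
qed

definition ext :: "'p set \<Rightarrow> 's \<Rightarrow> 't" where
  "ext U s = (THE t. t \<in> carrier (sections G U) \<and>
     (\<forall>B\<in>\<B>. B \<subseteq> U \<longrightarrow> res G U B t = \<psi> B (res F U B s)))"

lemma res_closed:
  assumes "semiring_sheaf X H" "openin X U" "openin X W" "W \<subseteq> U" "s \<in> carrier (sections H U)"
  shows "res H U W s \<in> carrier (sections H W)"
  using semiring_homD(1)[OF semiring_sheafD(2)[OF assms(1-4)] assms(5)] .

lemma ext_eqI:
  assumes U: "openin X U" and t: "t \<in> carrier (sections G U)"
    and eq: "\<And>B. B \<in> \<B> \<Longrightarrow> B \<subseteq> U \<Longrightarrow> res G U B t = \<psi> B (res F U B s)"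
  shows "ext U s = t"
  unfolding ext_def
proof (rule the_equality)
  fix t' assume t': "t' \<in> carrier (sections G U) \<and>
    (\<forall>B\<in>\<B>. B \<subseteq> U \<longrightarrow> res G U B t' = \<psi> B (res F U B s))"
  show "t' = t" by (rule basis_separated[OF G U]) (use t' t eq in auto)
qed (use t eq in blast)

text \<open>
  The local values \<open>\<psi> B (s|B)\<close> agree on overlaps by naturality of \<open>\<psi>\<close> over the basis, and so they
  glue to a section of the target sheaf.
\<close>

lemma ext_props:
  assumes U: "openin X U" and s: "s \<in> carrier (sections F U)"
  shows "ext U s \<in> carrier (sections G U)"
    and "B \<in> \<B> \<Longrightarrow> B \<subseteq> U \<Longrightarrow> res G U B (ext U s) = \<psi> B (res F U B s)"
proof -
  obtain t where t: "t \<in> carrier (sections G U)"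
    "\<And>B. B \<in> \<B> \<Longrightarrow> B \<subseteq> U \<Longrightarrow> res G U B t = \<psi> B (res F U B s)"
  proof (rule basis_glue[OF G U, where x = "\<lambda>B. \<psi> B (res F U B s)"])
    fix B assume B: "B \<in> \<B>" "B \<subseteq> U"
    then show "\<psi> B (res F U B s) \<in> carrier (sections G B)"
      using semiring_homD(1)[OF semiring_isoD(1)[OF iso]] res_closed[OF F U basis_open _ s] by blast
    fix A assume A: "A \<in> \<B>" "A \<subseteq> B"
    show "res G B A (\<psi> B (res F U B s)) = \<psi> A (res F U A s)"
      using natural[OF A(1) B(1) A(2)] res_closed[OF F U basis_open _ s] A B
        semiring_sheafD(4)[OF F U basis_open basis_open _ _ s] by (metis (no_types))
  qed blast
  have "ext U s = t" by (rule ext_eqI[OF U t(1)]) (rule t(2))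
  then show "ext U s \<in> carrier (sections G U)"
    "B \<in> \<B> \<Longrightarrow> B \<subseteq> U \<Longrightarrow> res G U B (ext U s) = \<psi> B (res F U B s)"
    using t by auto
qed

lemma ext_basis:
  assumes B: "B \<in> \<B>" and s: "s \<in> carrier (sections F B)"
  shows "ext B s = \<psi> B s"
proof (rule ext_eqI[OF basis_open[OF B]])
  show "\<psi> B s \<in> carrier (sections G B)"
    using semiring_homD(1)[OF semiring_isoD(1)[OF iso[OF B]] s] .
  fix A assume "A \<in> \<B>" "A \<subseteq> B"
  then show "res G B A (\<psi> B s) = \<psi> A (res F B A s)" using natural[OF _ B _ s] by simp
qed

lemma ext_natural:
  assumes U: "openin X U" and W: "openin X W" and sub: "W \<subseteq> U" and s: "s \<in> carrier (sections F U)"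
  shows "ext W (res F U W s) = res G U W (ext U s)"
proof (rule ext_eqI[OF W])
  note e = ext_props[OF U s]
  show "res G U W (ext U s) \<in> carrier (sections G W)" by (rule res_closed[OF G U W sub e(1)])
  fix B assume B: "B \<in> \<B>" "B \<subseteq> W"
  have "res G W B (res G U W (ext U s)) = res G U B (ext U s)"
    by (rule semiring_sheafD(4)[OF G U W basis_open[OF B(1)] B(2) sub e(1)])
  also have "\<dots> = \<psi> B (res F U B s)" using e(2) B sub by blast
  also have "\<dots> = \<psi> B (res F W B (res F U W s))"
    using semiring_sheafD(4)[OF F U W basis_open[OF B(1)] B(2) sub s] by simp
  finally show "res G W B (res G U W (ext U s)) = \<psi> B (res F W B (res F U W s))" .
qed

lemma ext_hom:
  assumes U: "openin X U"
  shows "ext U \<in> semiring_hom (sections F U) (sections G U)"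
proof -
  interpret FU: csemiring "sections F U" by (rule semiring_sheafD(1)[OF F U])
  interpret GU: csemiring "sections G U" by (rule semiring_sheafD(1)[OF G U])
  note e = ext_props[OF U]
  note rF = semiring_homD[OF semiring_sheafD(2)[OF F U basis_open]]
  note rG = semiring_homD[OF semiring_sheafD(2)[OF G U basis_open]]
  note p = semiring_homD[OF semiring_isoD(1)[OF iso]]
  show ?thesis
  proof (rule semiring_homI)
    fix x y assume xy: "x \<in> carrier (sections F U)" "y \<in> carrier (sections F U)"
    show "ext U (x \<otimes>\<^bsub>sections F U\<^esub> y) = ext U x \<otimes>\<^bsub>sections G U\<^esub> ext U y"
      using xy by (intro ext_eqI[OF U]) (simp_all add: e rF rG p)
    show "ext U (x \<oplus>\<^bsub>sections F U\<^esub> y) = ext U x \<oplus>\<^bsub>sections G U\<^esub> ext U y"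
      using xy by (intro ext_eqI[OF U]) (simp_all add: e rF rG p)
  next
    show "ext U x \<in> carrier (sections G U)" if "x \<in> carrier (sections F U)" for x
      using that by (rule e)
    show "ext U \<one>\<^bsub>sections F U\<^esub> = \<one>\<^bsub>sections G U\<^esub>" "ext U \<zero>\<^bsub>sections F U\<^esub> = \<zero>\<^bsub>sections G U\<^esub>"
      by (intro ext_eqI[OF U]; simp add: rF rG p)+
  qed
qed

text \<open>
  Injectivity is separatedness of the source; for surjectivity, the local preimages of a section of
  the target agree on overlaps because \<open>\<psi>\<close> is injective there, so they glue.
\<close>

lemma ext_bij:
  assumes U: "openin X U"
  shows "bij_betw (ext U) (carrier (sections F U)) (carrier (sections G U))"
proof -
  note e = ext_props[OF U]
  have inj: "s = t" if "B \<in> \<B>" "s \<in> carrier (sections F B)" "t \<in> carrier (sections F B)" "\<psi> B s = \<psi> B t"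
    for B s t
    using semiring_isoD(2)[OF iso[OF that(1)]] that by (auto simp: bij_betw_def inj_on_def)
  have "inj_on (ext U) (carrier (sections F U))"
  proof (rule inj_onI)
    fix s t assume st: "s \<in> carrier (sections F U)" "t \<in> carrier (sections F U)" "ext U s = ext U t"
    show "s = t"
    proof (rule basis_separated[OF F U st(1,2)])
      fix B assume B: "B \<in> \<B>" "B \<subseteq> U"
      then show "res F U B s = res F U B t"
        using inj[OF B(1) res_closed[OF F U basis_open _ st(1)] res_closed[OF F U basis_open _ st(2)]]
          e(2)[OF st(1) B] e(2)[OF st(2) B] st(3) by simp
    qed
  qed
  moreover have "\<exists>s\<in>carrier (sections F U). ext U s = t" if t: "t \<in> carrier (sections G U)" for t
  proof -
    define x where "x B = inv_into (carrier (sections F B)) (\<psi> B) (res G U B t)" for B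
    have x: "x B \<in> carrier (sections F B)" "\<psi> B (x B) = res G U B t" if B: "B \<in> \<B>" "B \<subseteq> U" for B
    proof -
      have "res G U B t \<in> \<psi> B ` carrier (sections F B)"
        using semiring_isoD(2)[OF iso[OF B(1)]] res_closed[OF G U basis_open[OF B(1)] B(2) t]
        by (simp add: bij_betw_def)
      then show "x B \<in> carrier (sections F B)" "\<psi> B (x B) = res G U B t"
        by (simp_all add: x_def inv_into_into f_inv_into_f)
    qed
    obtain s where s: "s \<in> carrier (sections F U)" "\<And>B. B \<in> \<B> \<Longrightarrow> B \<subseteq> U \<Longrightarrow> res F U B s = x B"
    proof (rule basis_glue[OF F U, of x])
      fix A B assume AB: "A \<in> \<B>" "B \<in> \<B>" "A \<subseteq> B" "B \<subseteq> U"
      have "\<psi> A (res F B A (x B)) = res G B A (res G U B t)"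
        using natural[OF AB(1-3)] x AB by simp
      also have "\<dots> = \<psi> A (x A)"
        using semiring_sheafD(4)[OF G U basis_open[OF AB(2)] basis_open[OF AB(1)] AB(3,4) t] x AB by auto
      finally show "res F B A (x B) = x A"
        using inj[OF AB(1) res_closed[OF F _ _ AB(3)]] basis_open AB x by auto
    qed (use x in auto)
    have "ext U s = t" by (rule ext_eqI[OF U t]) (simp add: s x)
    with s show ?thesis by blast
  qed
  ultimately show ?thesis using e(1) by (auto simp: bij_betw_def image_iff)
qed

lemma ext_iso:
  assumes "openin X U"
  shows "ext U \<in> semiring_iso (sections F U) (sections G U)"
  using ext_hom[OF assms] ext_bij[OF assms] by (simp add: semiring_iso_def)

end


section \<open>Direct images\<close>

lemma openin_open_preimage:
  "continuous_map X Y h \<Longrightarrow> openin Y U \<Longrightarrow> openin X (open_preimage X h U)"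
  by (simp add: continuous_map_def open_preimage_def)

lemma direct_image_sections [simp]:
  "sections (direct_image X h F) U = sections F (open_preimage X h U)"
  by (simp add: direct_image_def)

lemma direct_image_res [simp]:
  "res (direct_image X h F) U W = res F (open_preimage X h U) (open_preimage X h W)"
  by (simp add: direct_image_def)

lemma semiring_sheaf_direct_image:
  assumes F: "semiring_sheaf X F" and h: "continuous_map X Y h"
  shows "semiring_sheaf Y (direct_image X h F)"
proof -
  define pre where "pre = open_preimage X h"
  have op: "openin Y U \<Longrightarrow> openin X (pre U)" for U
    using openin_open_preimage[OF h] by (simp add: pre_def)
  have mono: "W \<subseteq> U \<Longrightarrow> pre W \<subseteq> pre U" for U W by (auto simp: pre_def open_preimage_def)
  have Int: "pre (U \<inter> W) = pre U \<inter> pre W" for U W by (auto simp: pre_def open_preimage_def)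
  have Un: "pre (\<Union>\<U>) = \<Union>(pre ` \<U>)" for \<U> by (auto simp: pre_def open_preimage_def)
  note FD = semiring_sheafD[OF F]
  have presheaf: "semiring_presheaf Y (direct_image X h F)"
    unfolding semiring_presheaf_def direct_image_sections direct_image_res pre_def[symmetric]
    by (auto intro: FD(1-3) FD(4) op dest: mono)
  have separated: "s = t"
    if "\<And>U. U \<in> \<U> \<Longrightarrow> openin Y U" "s \<in> carrier (sections F (pre (\<Union>\<U>)))" "t \<in> carrier (sections F (pre (\<Union>\<U>)))"
      "\<And>U. U \<in> \<U> \<Longrightarrow> res F (pre (\<Union>\<U>)) (pre U) s = res F (pre (\<Union>\<U>)) (pre U) t" for \<U> s t
    using FD(5)[of "pre ` \<U>" s t] that op unfolding Un by blast
  have glue: "\<exists>s\<in>carrier (sections F (pre (\<Union>\<U>))). \<forall>U\<in>\<U>. res F (pre (\<Union>\<U>)) (pre U) s = x U"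
    if o: "\<And>U. U \<in> \<U> \<Longrightarrow> openin Y U" and x: "\<And>U. U \<in> \<U> \<Longrightarrow> x U \<in> carrier (sections F (pre U))"
      and c: "\<And>U W. U \<in> \<U> \<Longrightarrow> W \<in> \<U> \<Longrightarrow>
        res F (pre U) (pre (U \<inter> W)) (x U) = res F (pre W) (pre (U \<inter> W)) (x W)" for \<U> x
  proof -
    \<comment> \<open>Distinct members of the cover may have the same preimage; compatibility on their
      intersection then says that they carry the same section.\<close>
    have same: "x U = x W" if "U \<in> \<U>" "W \<in> \<U>" "pre U = pre W" for U W
      using c[OF that(1,2)] FD(3)[OF op[OF o[OF that(1)]] x[OF that(1)]]
        FD(3)[OF op[OF o[OF that(2)]] x[OF that(2)]] that(3) by (simp add: Int)
    define y where "y A = x (SOME U. U \<in> \<U> \<and> pre U = A)" for A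
    have y: "y (pre U) = x U" if "U \<in> \<U>" for U
    proof -
      have "(SOME W. W \<in> \<U> \<and> pre W = pre U) \<in> \<U> \<and> pre (SOME W. W \<in> \<U> \<and> pre W = pre U) = pre U"
        by (rule someI[of _ U]) (simp add: that)
      then show ?thesis unfolding y_def using same that by blast
    qed
    have "\<exists>s\<in>carrier (sections F (\<Union>(pre ` \<U>))). \<forall>A\<in>pre ` \<U>. res F (\<Union>(pre ` \<U>)) A s = y A"
      using o op x c y by (intro FD(6)) (auto simp: Int)
    then show ?thesis using y by (auto simp: Un)
  qed
  show ?thesis
    unfolding semiring_sheaf_def direct_image_sections direct_image_res pre_def[symmetric]
  proof (intro conjI allI impI ballI)
    show "semiring_presheaf Y (direct_image X h F)" by fact
  next
    fix \<U> assume o: "\<forall>U\<in>\<U>. openin Y U"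
    show "s = t"
      if "s \<in> carrier (sections F (pre (\<Union>\<U>)))" "t \<in> carrier (sections F (pre (\<Union>\<U>)))"
        "\<forall>U\<in>\<U>. res F (pre (\<Union>\<U>)) (pre U) s = res F (pre (\<Union>\<U>)) (pre U) t" for s t
      by (rule separated[of \<U>]) (use o that in auto)
    show "\<exists>s\<in>carrier (sections F (pre (\<Union>\<U>))). \<forall>U\<in>\<U>. res F (pre (\<Union>\<U>)) (pre U) s = x U"
      if "(\<forall>U\<in>\<U>. x U \<in> carrier (sections F (pre U))) \<and>
        (\<forall>U\<in>\<U>. \<forall>W\<in>\<U>. res F (pre U) (pre (U \<inter> W)) (x U) = res F (pre W) (pre (U \<inter> W)) (x W))" for x
      by (rule glue) (use o that in auto)
  qed
qed

lemma ternary_sheafD: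
  assumes "ternary_sheaf \<Gamma> X F v"
  shows "openin X U \<Longrightarrow> ternary_semiring \<Gamma> (sections F U) (\<lambda>\<gamma>. v \<gamma> U)"
    and "openin X U \<Longrightarrow> openin X W \<Longrightarrow> W \<subseteq> U \<Longrightarrow> \<gamma> \<in> carrier \<Gamma> \<Longrightarrow> res F U W (v \<gamma> U) = v \<gamma> W"
  using assms unfolding ternary_sheaf_def by simp_all

lemma ternary_sheaf_direct_image:
  assumes F: "ternary_sheaf \<Gamma> X F v" and h: "continuous_map X Y h"
  shows "ternary_sheaf \<Gamma> Y (direct_image X h F) (direct_image_units X h v)"
proof -
  have "W \<subseteq> U \<Longrightarrow> open_preimage X h W \<subseteq> open_preimage X h U" for U W
    by (auto simp: open_preimage_def)
  moreover have "semiring_sheaf Y (direct_image X h F)"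
    using F by (intro semiring_sheaf_direct_image[OF _ h]) (simp add: ternary_sheaf_def)
  ultimately show ?thesis
    using F openin_open_preimage[OF h]
    by (simp add: ternary_sheaf_def direct_image_units_def)
qed


section \<open>The spectrum and its principal opens\<close>

context ternary_semiring
begin

lemma one_notin_prime:
  assumes "P \<in> Spec \<Gamma> T u"
  shows "\<one> \<notin> P"
proof
  assume one: "\<one> \<in> P"
  have gi: "gamma_ideal \<Gamma> T u P" and ne: "P \<noteq> carrier T"
    using assms by (auto simp: Spec_def prime_gamma_ideal_def)
  then have "carrier T \<subseteq> P" using gamma_ideal_mult[OF gi one] by fastforce
  then show False using gamma_ideal_subset[OF gi] ne by blast
qed

lemma D_one: "D \<Gamma> T u \<one> = Spec \<Gamma> T u"
  using one_notin_prime by (auto simp: D_def)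

lemma D_Int:
  assumes "f \<in> carrier T" "g \<in> carrier T"
  shows "D \<Gamma> T u f \<inter> D \<Gamma> T u g = D \<Gamma> T u (f \<otimes> g)"
proof -
  have "f \<otimes> g \<in> P \<longleftrightarrow> f \<in> P \<or> g \<in> P" if P: "P \<in> Spec \<Gamma> T u" for P
  proof
    have pr: "prime_gamma_ideal \<Gamma> T u P" using P by (simp add: Spec_def)
    then have gi: "gamma_ideal \<Gamma> T u P" by (simp add: prime_gamma_ideal_def)
    show "f \<in> P \<or> g \<in> P \<Longrightarrow> f \<otimes> g \<in> P" using gamma_ideal_mult[OF gi] assms by blast
    assume "f \<otimes> g \<in> P"
    then have "bracket T u \<one>\<^bsub>\<Gamma>\<^esub> f g \<one> \<in> P" using assms by (simp add: bracket_one)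
    then show "f \<in> P \<or> g \<in> P"
      using pr assms one_notin_prime[OF P] unfolding prime_gamma_ideal_def by blast
  qed
  then show ?thesis by (auto simp: D_def)
qed

lemma gamma_ideal_principal:
  assumes f: "f \<in> carrier T"
  shows "gamma_ideal \<Gamma> T u ((\<lambda>a. f \<otimes> a) ` carrier T)"
  unfolding gamma_ideal_def
proof (intro conjI ballI)
  show "submonoid ((\<lambda>a. f \<otimes> a) ` carrier T) (add_monoid T)"
  proof
    show "x \<otimes>\<^bsub>add_monoid T\<^esub> y \<in> (\<lambda>a. f \<otimes> a) ` carrier T"
      if "x \<in> (\<lambda>a. f \<otimes> a) ` carrier T" "y \<in> (\<lambda>a. f \<otimes> a) ` carrier T" for x y
      using that f by (auto simp flip: r_distr)
    show "\<one>\<^bsub>add_monoid T\<^esub> \<in> (\<lambda>a. f \<otimes> a) ` carrier T"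
      using f by (auto intro!: image_eqI[of _ _ \<zero>])
  qed (use f in auto)
  fix a b c \<gamma> assume "a \<in> (\<lambda>a. f \<otimes> a) ` carrier T" "b \<in> carrier T" "c \<in> carrier T" "\<gamma> \<in> carrier \<Gamma>"
  then show "bracket T u \<gamma> a b c \<in> (\<lambda>a. f \<otimes> a) ` carrier T"
    using f u_closed by (auto simp: bracket_def m_assoc)
qed

text \<open>
  A prime ideal contains \<open>f\<close> iff it contains the principal ideal generated by \<open>f\<close>.
\<close>

lemma openin_D:
  assumes f: "f \<in> carrier T"
  shows "openin (spec_topology \<Gamma> T u) (D \<Gamma> T u f)"
proof -
  let ?I = "(\<lambda>a. f \<otimes> a) ` carrier T"
  have "f \<in> P \<longleftrightarrow> ?I \<subseteq> P" if "P \<in> Spec \<Gamma> T u" for P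
  proof
    show "f \<in> P \<Longrightarrow> ?I \<subseteq> P"
      using that gamma_ideal_mult by (auto simp: Spec_def prime_gamma_ideal_def)
    have "f \<in> ?I" using f by (auto intro!: image_eqI[of _ _ \<one>])
    then show "?I \<subseteq> P \<Longrightarrow> f \<in> P" by blast
  qed
  then have "D \<Gamma> T u f = Spec \<Gamma> T u - V \<Gamma> T u ?I" by (auto simp: D_def V_def)
  then show ?thesis
    using gamma_ideal_principal[OF f] unfolding openin_spec_topology spec_open_def by blast
qed

lemma open_eq_Union_D:
  assumes "openin (spec_topology \<Gamma> T u) U"
  shows "\<Union>{B \<in> D \<Gamma> T u ` carrier T. B \<subseteq> U} = U"
proof -
  obtain I where I: "gamma_ideal \<Gamma> T u I" "U = Spec \<Gamma> T u - V \<Gamma> T u I"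
    using assms unfolding openin_spec_topology spec_open_def by blast
  have "U = (\<Union>f\<in>I. D \<Gamma> T u f)" unfolding I(2) by (auto simp: V_def D_def)
  then show ?thesis using gamma_ideal_subset[OF I(1)] by blast
qed

end


section \<open>The action of an automorphism on the spectrum\<close>

locale ternary_automorphism = ternary_semiring \<Gamma> T u
  for \<Gamma> :: "('g, 'k) monoid_scheme" and T :: "('a, 'm) ring_scheme" (structure) and u :: "'g \<Rightarrow> 'a" +
  fixes \<sigma> :: "'a \<Rightarrow> 'a"
  assumes Aut: "\<sigma> \<in> Aut_\<Gamma> \<Gamma> T u"

sublocale ternary_automorphism \<subseteq> csemiring_automorphism T \<sigma>
  using Aut by unfold_locales (simp add: Aut_\<Gamma>_def ternary_iso_def)

context ternary_automorphism
begin

lemma fix_units: "\<gamma> \<in> carrier \<Gamma> \<Longrightarrow> \<sigma> (u \<gamma>) = u \<gamma>"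
  using Aut by (simp add: Aut_\<Gamma>_def ternary_iso_def)

lemma hom_bracket:
  "\<lbrakk>a \<in> carrier T; b \<in> carrier T; c \<in> carrier T; \<gamma> \<in> carrier \<Gamma>\<rbrakk> \<Longrightarrow>
     \<sigma> (bracket T u \<gamma> a b c) = bracket T u \<gamma> (\<sigma> a) (\<sigma> b) (\<sigma> c)"
  by (simp add: bracket_def hom fix_units u_closed)

lemma bracket_closed:
  "\<lbrakk>a \<in> carrier T; b \<in> carrier T; c \<in> carrier T; \<gamma> \<in> carrier \<Gamma>\<rbrakk> \<Longrightarrow> bracket T u \<gamma> a b c \<in> carrier T"
  by (simp add: bracket_def u_closed)

lemma spec_map_in_Spec:
  assumes P: "P \<in> Spec \<Gamma> T u"
  shows "spec_map T \<sigma> P \<in> Spec \<Gamma> T u"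
proof -
  have pr: "prime_gamma_ideal \<Gamma> T u P" using P by (simp add: Spec_def)
  then have gi: "gamma_ideal \<Gamma> T u P" by (simp add: prime_gamma_ideal_def)
  then have sm: "submonoid P (add_monoid T)" by (simp add: gamma_ideal_def)
  have "submonoid (spec_map T \<sigma> P) (add_monoid T)"
    using submonoid.m_closed[OF sm] submonoid.one_closed[OF sm]
    by (intro submonoid.intro) (auto simp: spec_map_def hom)
  moreover have "bracket T u \<gamma> a b c \<in> spec_map T \<sigma> P"
    if "a \<in> spec_map T \<sigma> P" "b \<in> carrier T" "c \<in> carrier T" "\<gamma> \<in> carrier \<Gamma>" for a b c \<gamma>
    using that gi by (auto simp: spec_map_def hom_bracket bracket_closed gamma_ideal_def hom)
  ultimately have "gamma_ideal \<Gamma> T u (spec_map T \<sigma> P)" by (simp add: gamma_ideal_def)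
  moreover have "spec_map T \<sigma> P \<noteq> carrier T"
  proof -
    have "\<one> \<notin> spec_map T \<sigma> P" using one_notin_prime[OF P] by (simp add: spec_map_def hom)
    then show ?thesis using one_closed by blast
  qed
  moreover have "a \<in> spec_map T \<sigma> P \<or> b \<in> spec_map T \<sigma> P \<or> c \<in> spec_map T \<sigma> P"
    if "a \<in> carrier T" "b \<in> carrier T" "c \<in> carrier T" "\<gamma> \<in> carrier \<Gamma>"
      "bracket T u \<gamma> a b c \<in> spec_map T \<sigma> P" for a b c \<gamma>
  proof -
    have "bracket T u \<gamma> (\<sigma> a) (\<sigma> b) (\<sigma> c) \<in> P" using that by (simp add: spec_map_def hom_bracket)
    then have "\<sigma> a \<in> P \<or> \<sigma> b \<in> P \<or> \<sigma> c \<in> P"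
      using pr that hom(1) unfolding prime_gamma_ideal_def by blast
    then show ?thesis using that by (auto simp: spec_map_def)
  qed
  ultimately show ?thesis unfolding Spec_def prime_gamma_ideal_def mem_Collect_eq by blast
qed

lemma preimage_D:
  assumes "f \<in> carrier T"
  shows "open_preimage (spec_topology \<Gamma> T u) (spec_map T \<sigma>) (D \<Gamma> T u f) = D \<Gamma> T u (\<sigma> f)"
  using assms spec_map_in_Spec
  by (auto simp: open_preimage_def topspace_spec_topology D_def) (auto simp: spec_map_def)

lemma continuous_spec_map:
  "continuous_map (spec_topology \<Gamma> T u) (spec_topology \<Gamma> T u) (spec_map T \<sigma>)"
  unfolding continuous_map_def
proof (intro conjI allI impI)
  let ?X = "spec_topology \<Gamma> T u"
  show "spec_map T \<sigma> \<in> topspace ?X \<rightarrow> topspace ?X"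
    using spec_map_in_Spec by (auto simp: topspace_spec_topology)
  fix U assume U: "openin ?X U"
  have "{P \<in> topspace ?X. spec_map T \<sigma> P \<in> U} =
      (\<Union>f\<in>{f \<in> carrier T. D \<Gamma> T u f \<subseteq> U}. open_preimage ?X (spec_map T \<sigma>) (D \<Gamma> T u f))"
    using open_eq_Union_D[OF U] by (auto simp: open_preimage_def)
  also have "openin ?X \<dots>" using openin_D hom(1) by (auto simp: preimage_D)
  finally show "openin ?X {P \<in> topspace ?X. spec_map T \<sigma> P \<in> U}" .
qed

lemma inverse_in_Aut: "inv_into (carrier T) \<sigma> \<in> Aut_\<Gamma> \<Gamma> T u"
proof -
  let ?\<tau> = "inv_into (carrier T) \<sigma>"
  have inj: "inj_on \<sigma> (carrier T)" using bij by (simp add: bij_betw_def)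
  have "?\<tau> \<in> semiring_iso T T"
  proof (rule semiring_iso_factor[OF iso])
    show "(\<lambda>x. x) \<in> semiring_iso T T"
      by (auto simp: semiring_iso_def bij_betw_def intro: semiring_homI)
  qed (use inj in auto)
  moreover have "?\<tau> (u \<gamma>) = u \<gamma>" if "\<gamma> \<in> carrier \<Gamma>" for \<gamma>
    using inv_into_f_f[OF inj u_closed[OF that]] fix_units[OF that] by simp
  ultimately show ?thesis by (simp add: Aut_\<Gamma>_def ternary_iso_def)
qed

lemma homeomorphic_spec_map:
  "homeomorphic_map (spec_topology \<Gamma> T u) (spec_topology \<Gamma> T u) (spec_map T \<sigma>)"
proof -
  let ?\<tau> = "inv_into (carrier T) \<sigma>"
  interpret inv: ternary_automorphism \<Gamma> T u ?\<tau>
    by unfold_locales (rule inverse_in_Aut)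
  have left: "?\<tau> (\<sigma> a) = a" and right: "\<sigma> (?\<tau> a) = a" if "a \<in> carrier T" for a
    using bij that by (auto simp: bij_betw_inv_into_left bij_betw_inv_into_right)
  have sub: "P \<subseteq> carrier T" if "P \<in> Spec \<Gamma> T u" for P
    using that gamma_ideal_subset by (auto simp: Spec_def prime_gamma_ideal_def)
  have "homeomorphic_maps (spec_topology \<Gamma> T u) (spec_topology \<Gamma> T u) (spec_map T \<sigma>) (spec_map T ?\<tau>)"
    unfolding homeomorphic_maps_def topspace_spec_topology
  proof (intro conjI ballI continuous_spec_map inv.continuous_spec_map)
    fix P assume "P \<in> Spec \<Gamma> T u"
    then have "P \<subseteq> carrier T" by (rule sub)
    then show "spec_map T ?\<tau> (spec_map T \<sigma> P) = P" "spec_map T \<sigma> (spec_map T ?\<tau> P) = P"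
      by (auto simp: spec_map_def left right hom inv.hom subset_iff)
  qed
  then show ?thesis by (rule homeomorphic_maps_imp_map)
qed

end


section \<open>The action of an automorphism on the structure sheaf\<close>

locale ternary_structure_sheaf = ternary_semiring \<Gamma> T u
  for \<Gamma> :: "('g, 'k) monoid_scheme" and T :: "('a, 'm) ring_scheme" (structure) and u :: "'g \<Rightarrow> 'a" +
  fixes \<O> :: "('a set, 's) presheaf" and \<iota> :: "'a \<Rightarrow> ('a \<times> 'a) set \<Rightarrow> 's"
  assumes struct: "structure_sheaf \<Gamma> T u \<O> \<iota>"
begin

abbreviation "X \<equiv> spec_topology \<Gamma> T u"

lemma sheaf: "semiring_sheaf X \<O>"
  and \<iota>_iso: "f \<in> carrier T \<Longrightarrow> \<iota> f \<in> semiring_iso (localization T f) (sections \<O> (D \<Gamma> T u f))"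
  using struct by (auto simp: structure_sheaf_def)

lemmas \<iota>_hom = semiring_isoD(1)[OF \<iota>_iso]
lemmas csemiring_D = semiring_sheafD(1)[OF sheaf openin_D]

lemma res_\<iota>:
  assumes "f \<in> carrier T" "g \<in> carrier T" "D \<Gamma> T u g \<subseteq> D \<Gamma> T u f"
  obtains r where "canonical_hom T f g r"
    "\<And>x. x \<in> carrier (localization T f) \<Longrightarrow> res \<O> (D \<Gamma> T u f) (D \<Gamma> T u g) (\<iota> f x) = \<iota> g (r x)"
  using struct assms unfolding structure_sheaf_def by blast

lemma res_\<iota>_frac_one:
  assumes "f \<in> carrier T" "g \<in> carrier T" "D \<Gamma> T u g \<subseteq> D \<Gamma> T u f" and a: "a \<in> carrier T"
  shows "res \<O> (D \<Gamma> T u f) (D \<Gamma> T u g) (\<iota> f (frac T f a \<one>)) = \<iota> g (frac T g a \<one>)"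
proof -
  obtain r where r: "canonical_hom T f g r"
    "\<And>x. x \<in> carrier (localization T f) \<Longrightarrow> res \<O> (D \<Gamma> T u f) (D \<Gamma> T u g) (\<iota> f x) = \<iota> g (r x)"
    using res_\<iota>[OF assms(1-3)] by blast
  then show ?thesis
    using frac_in_localization[OF a powers_closed(1)[OF assms(1)]] a by (simp add: canonical_hom_def)
qed

lemma unit_section_D:
  assumes "f \<in> carrier T" "\<gamma> \<in> carrier \<Gamma>"
  shows "unit_section \<Gamma> T u \<O> \<iota> \<gamma> (D \<Gamma> T u f) = \<iota> f (frac T f (u \<gamma>) \<one>)"
  unfolding unit_section_def using assms u_closed
  by (intro res_\<iota>_frac_one) (auto simp: D_one, auto simp: D_def)

lemma ternary_sheaf: "ternary_sheaf \<Gamma> X \<O> (unit_section \<Gamma> T u \<O> \<iota>)"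
proof -
  have sub: "U \<subseteq> D \<Gamma> T u \<one>" if "openin X U" for U
    using openin_subset[OF that] by (simp add: D_one topspace_spec_topology)
  \<comment> \<open>the canonical homomorphism from \<open>T\<close> to the global sections\<close>
  define c where "c a = \<iota> \<one> (frac T \<one> a \<one>)" for a
  have c: "c \<in> semiring_hom T (sections \<O> (D \<Gamma> T u \<one>))"
    unfolding c_def by (rule semiring_hom_comp[OF canonical_map_hom \<iota>_hom]) auto
  have "ternary_semiring \<Gamma> (sections \<O> U) (\<lambda>\<gamma>. unit_section \<Gamma> T u \<O> \<iota> \<gamma> U)" if U: "openin X U" for U
    using ternary_semiring_hom_image[OF semiring_sheafD(1)[OF sheaf U]
        semiring_hom_comp[OF c semiring_sheafD(2)[OF sheaf openin_D[OF one_closed] U sub[OF U]]]]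
    by (simp add: unit_section_def c_def)
  moreover have "res \<O> U W (unit_section \<Gamma> T u \<O> \<iota> \<gamma> U) = unit_section \<Gamma> T u \<O> \<iota> \<gamma> W"
    if "openin X U" "openin X W" "W \<subseteq> U" "\<gamma> \<in> carrier \<Gamma>" for U W \<gamma>
    using semiring_sheafD(4)[OF sheaf openin_D[OF one_closed] that(1,2,3) sub[OF that(1)]]
      semiring_homD(1)[OF c u_closed[OF that(4)]]
    by (simp add: unit_section_def c_def)
  ultimately show ?thesis using sheaf by (simp add: ternary_sheaf_def)
qed

end

locale structure_sheaf_automorphism =
  ternary_structure_sheaf \<Gamma> T u \<O> \<iota> + ternary_automorphism \<Gamma> T u \<sigma>
  for \<Gamma> :: "('g, 'k) monoid_scheme" and T :: "('a, 'm) ring_scheme" (structure) and u :: "'g \<Rightarrow> 'a"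
    and \<O> :: "('a set, 's) presheaf" and \<iota> :: "'a \<Rightarrow> ('a \<times> 'a) set \<Rightarrow> 's" and \<sigma> :: "'a \<Rightarrow> 'a"
begin

abbreviation "\<O>' \<equiv> direct_image X (spec_map T \<sigma>) \<O>"

text \<open>
  Both sides are homomorphisms from \<open>T\<^sub>f\<close> to the sections over \<open>D (\<sigma> g)\<close> that send \<open>a/1\<close> to the
  section \<open>\<sigma>(a)/1\<close>, so they agree by \<open>localization_hom_eq\<close>.
\<close>

lemma res_\<iota>_frac_map:
  assumes f: "f \<in> carrier T" and g: "g \<in> carrier T" and sub: "D \<Gamma> T u g \<subseteq> D \<Gamma> T u f"
    and r: "canonical_hom T f g r" and x: "x \<in> carrier (localization T f)"
  shows "res \<O> (D \<Gamma> T u (\<sigma> f)) (D \<Gamma> T u (\<sigma> g)) (\<iota> (\<sigma> f) (frac_map \<sigma> x)) = \<iota> (\<sigma> g) (frac_map \<sigma> (r x))"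
proof -
  have \<sigma>f: "\<sigma> f \<in> carrier T" and \<sigma>g: "\<sigma> g \<in> carrier T" using f g hom(1) by auto
  have sub': "D \<Gamma> T u (\<sigma> g) \<subseteq> D \<Gamma> T u (\<sigma> f)"
    using sub f g by (auto simp flip: preimage_D simp: open_preimage_def)
  have rh: "r \<in> semiring_hom (localization T f) (localization T g)"
    and r1: "\<And>a. a \<in> carrier T \<Longrightarrow> r (frac T f a \<one>) = frac T g a \<one>"
    using r by (auto simp: canonical_hom_def)
  note fm = semiring_isoD(1)[OF frac_map_iso]
  show ?thesis
  proof (rule localization_hom_eq[OF f csemiring_D[OF \<sigma>g] _ _ _ x])
    show "(\<lambda>x. res \<O> (D \<Gamma> T u (\<sigma> f)) (D \<Gamma> T u (\<sigma> g)) (\<iota> (\<sigma> f) (frac_map \<sigma> x)))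
        \<in> semiring_hom (localization T f) (sections \<O> (D \<Gamma> T u (\<sigma> g)))"
      by (intro semiring_hom_comp[OF semiring_hom_comp[OF fm[OF f] \<iota>_hom[OF \<sigma>f]]]
          semiring_sheafD(2)[OF sheaf] openin_D \<sigma>f \<sigma>g sub')
    show "(\<lambda>x. \<iota> (\<sigma> g) (frac_map \<sigma> (r x)))
        \<in> semiring_hom (localization T f) (sections \<O> (D \<Gamma> T u (\<sigma> g)))"
      by (rule semiring_hom_comp[OF semiring_hom_comp[OF rh fm[OF g]] \<iota>_hom[OF \<sigma>g]])
    fix a assume a: "a \<in> carrier T"
    show "res \<O> (D \<Gamma> T u (\<sigma> f)) (D \<Gamma> T u (\<sigma> g)) (\<iota> (\<sigma> f) (frac_map \<sigma> (frac T f a \<one>))) =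
        \<iota> (\<sigma> g) (frac_map \<sigma> (r (frac T f a \<one>)))"
      using a f g \<sigma>f \<sigma>g sub' powers_closed
      by (simp add: r1 frac_map_frac hom res_\<iota>_frac_one)
  qed
qed

text \<open>
  The same open set is \<open>D f\<close> for many \<open>f\<close>, so a generator has to be chosen;
  \<open>basis_map_\<iota>\<close> shows that the choice does not matter.
\<close>

definition basis_map :: "'a set set \<Rightarrow> 's \<Rightarrow> 's" where
  "basis_map B s = (let f = (SOME f. f \<in> carrier T \<and> D \<Gamma> T u f = B)
     in \<iota> (\<sigma> f) (frac_map \<sigma> (inv_into (carrier (localization T f)) (\<iota> f) s)))"

lemma basis_map_\<iota>:
  assumes f: "f \<in> carrier T" and x: "x \<in> carrier (localization T f)"
  shows "basis_map (D \<Gamma> T u f) (\<iota> f x) = \<iota> (\<sigma> f) (frac_map \<sigma> x)"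
proof -
  define g where "g = (SOME g. g \<in> carrier T \<and> D \<Gamma> T u g = D \<Gamma> T u f)"
  have "g \<in> carrier T \<and> D \<Gamma> T u g = D \<Gamma> T u f"
    unfolding g_def by (rule someI[of _ f]) (simp add: f)
  then have g: "g \<in> carrier T" and Dg: "D \<Gamma> T u g = D \<Gamma> T u f" by auto
  have \<sigma>f: "\<sigma> f \<in> carrier T" using f by (rule hom)
  have D\<sigma>g: "D \<Gamma> T u (\<sigma> g) = D \<Gamma> T u (\<sigma> f)" using f g Dg by (simp flip: preimage_D)
  obtain r where r: "canonical_hom T f g r"
    "\<And>x. x \<in> carrier (localization T f) \<Longrightarrow> res \<O> (D \<Gamma> T u f) (D \<Gamma> T u g) (\<iota> f x) = \<iota> g (r x)"
    using res_\<iota>[OF f g] Dg by blast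
  have rx: "r x \<in> carrier (localization T g)"
    using r(1) x semiring_homD(1) by (fastforce simp: canonical_hom_def)
  have "\<iota> f x = \<iota> g (r x)"
    using r(2)[OF x] semiring_sheafD(3)[OF sheaf openin_D[OF f] semiring_homD(1)[OF \<iota>_hom[OF f] x]]
    by (simp add: Dg)
  then have "inv_into (carrier (localization T g)) (\<iota> g) (\<iota> f x) = r x"
    using semiring_isoD(2)[OF \<iota>_iso[OF g]] rx by (simp add: bij_betw_def)
  then have "basis_map (D \<Gamma> T u f) (\<iota> f x) = \<iota> (\<sigma> g) (frac_map \<sigma> (r x))"
    by (simp add: basis_map_def flip: g_def)
  also have "\<dots> = res \<O> (D \<Gamma> T u (\<sigma> f)) (D \<Gamma> T u (\<sigma> g)) (\<iota> (\<sigma> f) (frac_map \<sigma> x))"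
    using res_\<iota>_frac_map[OF f g _ r(1) x] Dg by simp
  also have "\<dots> = \<iota> (\<sigma> f) (frac_map \<sigma> x)"
    unfolding D\<sigma>g
    using semiring_homD(1)[OF \<iota>_hom[OF \<sigma>f]] semiring_homD(1)[OF semiring_isoD(1)[OF frac_map_iso[OF f]] x]
    by (intro semiring_sheafD(3)[OF sheaf openin_D[OF \<sigma>f]])
  finally show ?thesis .
qed

sublocale basis_isomorphism X \<O> \<O>' "D \<Gamma> T u ` carrier T" basis_map
proof
  show "semiring_sheaf X \<O>" by (rule sheaf)
  show "semiring_sheaf X \<O>'" by (rule semiring_sheaf_direct_image[OF sheaf continuous_spec_map])
  show "openin X B" if "B \<in> D \<Gamma> T u ` carrier T" for B using that openin_D by blast
  show "A \<inter> B \<in> D \<Gamma> T u ` carrier T" if "A \<in> D \<Gamma> T u ` carrier T" "B \<in> D \<Gamma> T u ` carrier T" for A B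
    using that by (auto simp: D_Int)
  show "\<Union>{B \<in> D \<Gamma> T u ` carrier T. B \<subseteq> U} = U" if "openin X U" for U
    using that by (rule open_eq_Union_D)
next
  fix B assume "B \<in> D \<Gamma> T u ` carrier T"
  then obtain f where f: "f \<in> carrier T" "B = D \<Gamma> T u f" by blast
  have "basis_map (D \<Gamma> T u f) \<in> semiring_iso (sections \<O> (D \<Gamma> T u f)) (sections \<O> (D \<Gamma> T u (\<sigma> f)))"
    using semiring_iso_factor[OF \<iota>_iso[OF f(1)]
        semiring_iso_comp[OF frac_map_iso[OF f(1)] \<iota>_iso[OF hom(1)[OF f(1)]]]
        basis_map_\<iota>[OF f(1)]] localization_closed[OF f(1)] by blast
  then show "basis_map B \<in> semiring_iso (sections \<O> B) (sections \<O>' B)"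
    using f by (simp add: preimage_D)
next
  fix A B s assume "A \<in> D \<Gamma> T u ` carrier T" "B \<in> D \<Gamma> T u ` carrier T" "A \<subseteq> B"
    and s: "s \<in> carrier (sections \<O> B)"
  then obtain f g where f: "f \<in> carrier T" "B = D \<Gamma> T u f" and g: "g \<in> carrier T" "A = D \<Gamma> T u g"
    and sub: "D \<Gamma> T u g \<subseteq> D \<Gamma> T u f" by blast
  obtain x where x: "x \<in> carrier (localization T f)" "s = \<iota> f x"
    using semiring_isoD(2)[OF \<iota>_iso[OF f(1)]] s f by (auto simp: bij_betw_def)
  obtain r where r: "canonical_hom T f g r"
    "\<And>x. x \<in> carrier (localization T f) \<Longrightarrow> res \<O> (D \<Gamma> T u f) (D \<Gamma> T u g) (\<iota> f x) = \<iota> g (r x)"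
    using res_\<iota>[OF f(1) g(1) sub] by blast
  have "r x \<in> carrier (localization T g)"
    using r(1) x semiring_homD(1) by (fastforce simp: canonical_hom_def)
  then show "basis_map A (res \<O> B A s) = res \<O>' B A (basis_map B s)"
    using f g x r res_\<iota>_frac_map[OF f(1) g(1) sub r(1) x(1)]
    by (simp add: basis_map_\<iota> preimage_D)
qed

text \<open>
  Over \<open>D f\<close> the unit section of \<open>\<gamma>\<close> is the fraction \<open>u\<^sub>\<gamma>/1\<close>, which is sent to \<open>\<sigma>(u\<^sub>\<gamma>)/1 = u\<^sub>\<gamma>/1\<close>.
\<close>

lemma ext_unit_section:
  assumes U: "openin X U" and \<gamma>: "\<gamma> \<in> carrier \<Gamma>"
  shows "ext U (unit_section \<Gamma> T u \<O> \<iota> \<gamma> U) =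
    direct_image_units X (spec_map T \<sigma>) (unit_section \<Gamma> T u \<O> \<iota>) \<gamma> U"
proof (rule ext_eqI[OF U])
  let ?v = "unit_section \<Gamma> T u \<O> \<iota>" and ?v' = "direct_image_units X (spec_map T \<sigma>) (unit_section \<Gamma> T u \<O> \<iota>)"
  have v': "ternary_sheaf \<Gamma> X \<O>' ?v'"
    by (rule ternary_sheaf_direct_image[OF ternary_sheaf continuous_spec_map])
  show "?v' \<gamma> U \<in> carrier (sections \<O>' U)"
    by (rule ternary_semiring.u_closed[OF ternary_sheafD(1)[OF v' U] \<gamma>])
  fix B assume B: "B \<in> D \<Gamma> T u ` carrier T" "B \<subseteq> U"
  then obtain f where f: "f \<in> carrier T" "B = D \<Gamma> T u f" by blast
  have "res \<O> U B (?v \<gamma> U) = ?v \<gamma> B" "res \<O>' U B (?v' \<gamma> U) = ?v' \<gamma> B"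
    by (intro ternary_sheafD(2)[OF ternary_sheaf U basis_open[OF B(1)] B(2) \<gamma>]
        ternary_sheafD(2)[OF v' U basis_open[OF B(1)] B(2) \<gamma>])+
  moreover have "basis_map B (?v \<gamma> B) = ?v' \<gamma> B"
    using f \<gamma> u_closed[OF \<gamma>] powers_closed(1)[OF f(1)]
    by (simp add: direct_image_units_def preimage_D unit_section_D basis_map_\<iota>
        frac_in_localization frac_map_frac hom fix_units)
  ultimately show "res \<O>' U B (?v' \<gamma> U) = basis_map B (res \<O> U B (?v \<gamma> U))" by simp
qed

lemma ternary_sheaf_iso_ext:
  "ternary_sheaf_iso \<Gamma> X \<O> (unit_section \<Gamma> T u \<O> \<iota>) \<O>'
     (direct_image_units X (spec_map T \<sigma>) (unit_section \<Gamma> T u \<O> \<iota>)) ext"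
  unfolding ternary_sheaf_iso_def ternary_iso_def
  using ternary_sheaf ternary_sheaf_direct_image[OF ternary_sheaf continuous_spec_map]
    ext_iso ext_unit_section ext_natural by blast

lemma induced_by_ext: "induced_by \<Gamma> T u \<iota> \<sigma> ext"
  unfolding induced_by_def
proof (intro ballI)
  fix f a s assume *: "f \<in> carrier T" "a \<in> carrier T" "s \<in> powers T f"
  note fr = frac_in_localization[OF *(2,3)]
  show "ext (D \<Gamma> T u f) (\<iota> f (frac T f a s)) = \<iota> (\<sigma> f) (frac T (\<sigma> f) (\<sigma> a) (\<sigma> s))"
    using * fr semiring_homD(1)[OF \<iota>_hom[OF *(1)] fr]
    by (simp add: ext_basis basis_map_\<iota> frac_map_frac)
qed

end


theorem proposition3:
  fixes \<Gamma> :: "('g, 'k) monoid_scheme" and T :: "('a, 'm) ring_scheme" and u :: "'g \<Rightarrow> 'a"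
    and \<O> :: "('a set, 's) presheaf" and \<iota> :: "'a \<Rightarrow> ('a \<times> 'a) set \<Rightarrow> 's" and \<sigma> :: "'a \<Rightarrow> 'a"
  assumes "ternary_semiring \<Gamma> T u"
    and "structure_sheaf \<Gamma> T u \<O> \<iota>"
    and "\<sigma> \<in> Aut_\<Gamma> \<Gamma> T u"
  shows "let X = spec_topology \<Gamma> T u;
             \<sigma>_star = spec_map T \<sigma>;
             v = unit_section \<Gamma> T u \<O> \<iota>;
             \<O>' = direct_image X \<sigma>_star \<O>;
             v' = direct_image_units X \<sigma>_star v
         in homeomorphic_map X X \<sigma>_star \<and>
            (\<exists>\<sigma>_sharp.
               induced_by \<Gamma> T u \<iota> \<sigma> \<sigma>_sharp \<and>
               ternary_sheaf_iso \<Gamma> X \<O> v \<O>' v' \<sigma>_sharp \<and>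
               (\<forall>U. openin X U \<longrightarrow>
                  (\<forall>\<gamma>\<in>carrier \<Gamma>. \<forall>s\<^sub>1\<in>carrier (sections \<O> U).
                     \<forall>s\<^sub>2\<in>carrier (sections \<O> U). \<forall>s\<^sub>3\<in>carrier (sections \<O> U).
                     \<sigma>_sharp U (bracket (sections \<O> U) (\<lambda>\<gamma>. v \<gamma> U) \<gamma> s\<^sub>1 s\<^sub>2 s\<^sub>3) =
                     bracket (sections \<O>' U) (\<lambda>\<gamma>. v' \<gamma> U) \<gamma>
                       (\<sigma>_sharp U s\<^sub>1) (\<sigma>_sharp U s\<^sub>2) (\<sigma>_sharp U s\<^sub>3))))"
proof -
  interpret structure_sheaf_automorphism \<Gamma> T u \<O> \<iota> \<sigma>
    using assms
    by (intro structure_sheaf_automorphism.intro ternary_structure_sheaf.intro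
        ternary_automorphism.intro ternary_structure_sheaf_axioms.intro
        ternary_automorphism_axioms.intro)
  let ?v = "unit_section \<Gamma> T u \<O> \<iota>"
  let ?v' = "direct_image_units X (spec_map T \<sigma>) ?v"
  have "ext U (bracket (sections \<O> U) (\<lambda>\<gamma>. ?v \<gamma> U) \<gamma> s\<^sub>1 s\<^sub>2 s\<^sub>3) =
      bracket (sections \<O>' U) (\<lambda>\<gamma>. ?v' \<gamma> U) \<gamma> (ext U s\<^sub>1) (ext U s\<^sub>2) (ext U s\<^sub>3)"
    if "openin X U" "\<gamma> \<in> carrier \<Gamma>" "s\<^sub>1 \<in> carrier (sections \<O> U)"
      "s\<^sub>2 \<in> carrier (sections \<O> U)" "s\<^sub>3 \<in> carrier (sections \<O> U)" for U \<gamma> s\<^sub>1 s\<^sub>2 s\<^sub>3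
  proof (rule ternary_iso_bracket)
    show "ternary_semiring \<Gamma> (sections \<O> U) (\<lambda>\<gamma>. ?v \<gamma> U)"
      by (rule ternary_sheafD(1)[OF ternary_sheaf that(1)])
    show "ext U \<in> ternary_iso \<Gamma> (sections \<O> U) (\<lambda>\<gamma>. ?v \<gamma> U) (sections \<O>' U) (\<lambda>\<gamma>. ?v' \<gamma> U)"
      using ternary_sheaf_iso_ext that(1) unfolding ternary_sheaf_iso_def by blast
  qed (use that in auto)
  then show ?thesis
    unfolding Let_def
    using homeomorphic_spec_map induced_by_ext ternary_sheaf_iso_ext by blast
qed

end
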